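(* Let $\Sigma=\mathbb N\setminus\{1\}=\{0,2,3,4,\ldots\}$, regarded as an additive submonoid of $\mathbb Z$. Suppose $\{V_p\}_{p\in\Sigma}$ is a family of elements of a $\mathrm C^*$-algebra satisfying the relations (T1)--(T3) (for $P=\Sigma$) together with the extra relation $$V_3^*V_2V_2^*V_3=V_2V_2^*+V_3V_3^*-V_2V_2^*V_3V_3^*.$$ Then $L_p\mapsto V_p$ extends to a $*$-homomorphism $\pi_V\colon\mathcal T_\lambda(\Sigma)\to\mathrm C^*(V_p:p\in\Sigma)$. Moreover, $\pi_V$ is an isomorphism if and only if $V_3^*V_2V_2^*V_3\neq1$.
   Context: $\mathcal T_\lambda(\Sigma)$ is the $\mathrm C^*$-algebra generated by the isometries $L_p\delta_q=\delta_{p+q}$ ($p,q\in\Sigma$) on $\ell^2(\Sigma)$. A word is a finite sequence $\alpha=(p_1,p_2,\ldots,p_{2k-1},p_{2k})$ of even length $2k\ge 0$ with entries in $\Sigma$; it is neutral if $-p_1+p_2-\cdots-p_{2k-1}+p_{2k}=0$. Put $K(\alpha):=\Sigma\cap(-p_{2k}+p_{2k-1}+\Sigma)\cap(-p_{2k}+p_{2k-1}-p_{2k-2}+p_{2k-3}+\Sigma)\cap\cdots\cap(-p_{2k}+p_{2k-1}-\cdots-p_2+p_1+\Sigma)$ (equal to $\Sigma$ for the empty word), and $\dot V_\alpha:=V_{p_1}^*V_{p_2}\cdots V_{p_{2k-1}}^*V_{p_{2k}}$ ($=1$ for the empty word). The relations are: (T1) $V_0=1$; (T2) $\dot V_\alpha=0$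 if $\alpha$ is neutral and $K(\alpha)=\emptyset$ (this never occurs for $\Sigma$); (T3) $\dot V_\alpha=\dot V_\beta$ if $\alpha,\beta$ are neutral and $K(\alpha)=K(\beta)$. *)

theory Defs
  imports "HOL-Analysis.Analysis"
begin

section \<open>Unital C*-algebras\<close>

class scaleC = scaleR +
  fixes scaleC :: "complex \<Rightarrow> 'a \<Rightarrow> 'a"  (infixr \<open>*\<^sub>C\<close> 75)

text \<open>
  The superclass \<open>monoid_mult\<close> is used instead of \<open>ring_1\<close>, so that the zero algebra
  (in which \<open>1 = 0\<close>) is admitted.
\<close>

class unital_cstar_algebra = real_normed_algebra + banach + monoid_mult + scaleC +
  fixes star :: "'a \<Rightarrow> 'a"
  assumes scaleC_of_real: "complex_of_real r *\<^sub>C x = r *\<^sub>R x"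
    and scaleC_add_left: "(a + b) *\<^sub>C x = a *\<^sub>C x + b *\<^sub>C x"
    and scaleC_add_right: "a *\<^sub>C (x + y) = a *\<^sub>C x + a *\<^sub>C y"
    and scaleC_scaleC: "a *\<^sub>C (b *\<^sub>C x) = (a * b) *\<^sub>C x"
    and norm_scaleC: "norm (a *\<^sub>C x) = cmod a * norm x"
    and mult_scaleC_left: "(a *\<^sub>C x) * y = a *\<^sub>C (x * y)"
    and mult_scaleC_right: "x * (a *\<^sub>C y) = a *\<^sub>C (x * y)"
    and star_star: "star (star x) = x"
    and star_add: "star (x + y) = star x + star y"
    and star_scaleC: "star (a *\<^sub>C x) = cnj a *\<^sub>C star x"
    and star_mult: "star (x * y) = star y * star x"
    and cstar_identity: "norm (star x * x) = (norm x)\<^sup>2"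

definition cstar_subalgebra :: "'a::unital_cstar_algebra set \<Rightarrow> bool" where
  "cstar_subalgebra B \<longleftrightarrow>
     closed B \<and> 0 \<in> B \<and>
     (\<forall>x\<in>B. \<forall>y\<in>B. x + y \<in> B) \<and> (\<forall>x\<in>B. \<forall>y\<in>B. x * y \<in> B) \<and>
     (\<forall>c. \<forall>x\<in>B. c *\<^sub>C x \<in> B) \<and> (\<forall>x\<in>B. star x \<in> B)"

definition cstar_generated :: "'a::unital_cstar_algebra set \<Rightarrow> 'a set" where
  "cstar_generated S = \<Inter>{B. cstar_subalgebra B \<and> S \<subseteq> B}"

definition star_hom ::
  "'a::unital_cstar_algebra set \<Rightarrow> 'b::unital_cstar_algebra set \<Rightarrow> ('a \<Rightarrow> 'b) \<Rightarrow> bool" where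
  "star_hom A B \<pi> \<longleftrightarrow>
     (\<forall>x\<in>A. \<pi> x \<in> B) \<and>
     (\<forall>x\<in>A. \<forall>y\<in>A. \<pi> (x + y) = \<pi> x + \<pi> y) \<and>
     (\<forall>c. \<forall>x\<in>A. \<pi> (c *\<^sub>C x) = c *\<^sub>C \<pi> x) \<and>
     (\<forall>x\<in>A. \<forall>y\<in>A. \<pi> (x * y) = \<pi> x * \<pi> y) \<and>
     (\<forall>x\<in>A. \<pi> (star x) = star (\<pi> x))"

definition star_iso ::
  "'a::unital_cstar_algebra set \<Rightarrow> 'b::unital_cstar_algebra set \<Rightarrow> ('a \<Rightarrow> 'b) \<Rightarrow> bool" where
  "star_iso A B \<pi> \<longleftrightarrow> star_hom A B \<pi> \<and> bij_betw \<pi> A B"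


section \<open>The Hilbert space of square-summable families\<close>

typedef 'i ell2 = "{f :: 'i \<Rightarrow> complex. (\<lambda>i. (cmod (f i))\<^sup>2) summable_on UNIV}"
  morphisms coord ell2_of
  by (rule exI[of _ "\<lambda>_. 0"]) simp

setup_lifting type_definition_ell2

lemma coord_summable: "(\<lambda>i. (cmod (coord x i))\<^sup>2) summable_on UNIV"
  using coord[of x] by simp

lemma ell2_eqI: "(\<And>i. coord x i = coord y i) \<Longrightarrow> x = y"
  by (simp add: coord_inject[symmetric] fun_eq_iff)

lemma square_summable_add:
  fixes f g :: "'i \<Rightarrow> complex"
  assumes "(\<lambda>i. (cmod (f i))\<^sup>2) summable_on A" "(\<lambda>i. (cmod (g i))\<^sup>2) summable_on A"
  shows "(\<lambda>i. (cmod (f i + g i))\<^sup>2) summable_on A"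
proof (rule summable_on_comparison_test)
  show "(\<lambda>i. 2 * (cmod (f i))\<^sup>2 + 2 * (cmod (g i))\<^sup>2) summable_on A"
    by (intro summable_on_add summable_on_cmult_right assms)
  fix i
  have "(cmod (f i + g i))\<^sup>2 \<le> (cmod (f i) + cmod (g i))\<^sup>2"
    by (intro power_mono norm_triangle_ineq) simp
  also have "\<dots> \<le> 2 * (cmod (f i))\<^sup>2 + 2 * (cmod (g i))\<^sup>2"
    using sum_squares_bound[of "cmod (f i)" "cmod (g i)"] by (simp add: power2_sum)
  finally show "(cmod (f i + g i))\<^sup>2 \<le> 2 * (cmod (f i))\<^sup>2 + 2 * (cmod (g i))\<^sup>2" .
qed simp

lemma square_summable_cmult:
  fixes f :: "'i \<Rightarrow> complex"
  assumes "(\<lambda>i. (cmod (f i))\<^sup>2) summable_on A"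
  shows "(\<lambda>i. (cmod (c * f i))\<^sup>2) summable_on A"
  using summable_on_cmult_right[OF assms, of "(cmod c)\<^sup>2"]
  by (simp add: norm_mult power_mult_distrib)

definition cinner :: "'i ell2 \<Rightarrow> 'i ell2 \<Rightarrow> complex" where
  "cinner x y = (\<Sum>\<^sub>\<infinity>i. coord x i * cnj (coord y i))"

lemma cinner_summable: "(\<lambda>i. coord x i * cnj (coord y i)) summable_on UNIV"
proof -
  have "(\<lambda>i. norm (coord x i * cnj (coord y i))) summable_on UNIV"
    by (rule abs_summable_product)
      (use coord_summable[of x] coord_summable[of y] in \<open>simp_all add: norm_mult power2_eq_square\<close>)
  then show ?thesis
    by (rule abs_summable_summable)
qed

instantiation ell2 :: (type) real_vector
begin
lift_definition zero_ell2 :: "'a ell2" is "\<lambda>_. 0" by simp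
lift_definition plus_ell2 :: "'a ell2 \<Rightarrow> 'a ell2 \<Rightarrow> 'a ell2" is "\<lambda>f g i. f i + g i"
  by (rule square_summable_add)
lift_definition uminus_ell2 :: "'a ell2 \<Rightarrow> 'a ell2" is "\<lambda>f i. - f i" by simp
lift_definition minus_ell2 :: "'a ell2 \<Rightarrow> 'a ell2 \<Rightarrow> 'a ell2" is "\<lambda>f g i. f i - g i"
proof -
  fix f g :: "'a \<Rightarrow> complex"
  assume "(\<lambda>i. (cmod (f i))\<^sup>2) summable_on UNIV" "(\<lambda>i. (cmod (g i))\<^sup>2) summable_on UNIV"
  then show "(\<lambda>i. (cmod (f i - g i))\<^sup>2) summable_on UNIV"
    using square_summable_add[of f UNIV "\<lambda>i. - g i"] by simp
qed
lift_definition scaleR_ell2 :: "real \<Rightarrow> 'a ell2 \<Rightarrow> 'a ell2" is "\<lambda>r f i. complex_of_real r * f i"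
  by (rule square_summable_cmult)
instance
  by standard (transfer; simp add: algebra_simps fun_eq_iff)+
end

instantiation ell2 :: (type) scaleC
begin
lift_definition scaleC_ell2 :: "complex \<Rightarrow> 'a ell2 \<Rightarrow> 'a ell2" is "\<lambda>c f i. c * f i"
  by (rule square_summable_cmult)
instance ..
end

lemmas coord_simps [simp] =
  zero_ell2.rep_eq plus_ell2.rep_eq uminus_ell2.rep_eq minus_ell2.rep_eq
  scaleR_ell2.rep_eq scaleC_ell2.rep_eq

lemma cinner_add_left: "cinner (x + y) z = cinner x z + cinner y z"
  unfolding cinner_def by (simp add: algebra_simps infsum_add cinner_summable)

lemma cinner_scaleC_left: "cinner (c *\<^sub>C x) y = c * cinner x y"
  unfolding cinner_def
  by (simp add: mult.assoc infsum_cmult_right cinner_summable)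

lemma cinner_commute: "cinner x y = cnj (cinner y x)"
  unfolding cinner_def infsum_cnj[symmetric] by (simp add: mult.commute)

lemma cinner_self: "cinner x x = complex_of_real (\<Sum>\<^sub>\<infinity>i. (cmod (coord x i))\<^sup>2)"
  unfolding cinner_def complex_norm_square[symmetric] of_real_power[symmetric]
  by (intro infsumI has_sum_of_real has_sum_infsum coord_summable)

lemma scaleR_scaleC_ell2: "r *\<^sub>R (x :: 'i ell2) = complex_of_real r *\<^sub>C x"
  by (rule ell2_eqI) simp

instantiation ell2 :: (type) real_inner
begin
definition inner_ell2 :: "'a ell2 \<Rightarrow> 'a ell2 \<Rightarrow> real" where
  "inner_ell2 x y = Re (cinner x y)"
definition norm_ell2 :: "'a ell2 \<Rightarrow> real" where
  "norm_ell2 x = sqrt (\<Sum>\<^sub>\<infinity>i. (cmod (coord x i))\<^sup>2)"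
definition dist_ell2 :: "'a ell2 \<Rightarrow> 'a ell2 \<Rightarrow> real" where
  "dist_ell2 x y = norm (x - y)"
definition sgn_ell2 :: "'a ell2 \<Rightarrow> 'a ell2" where
  "sgn_ell2 x = x /\<^sub>R norm x"
definition uniformity_ell2 :: "('a ell2 \<times> 'a ell2) filter" where
  "uniformity_ell2 = (INF e\<in>{0 <..}. principal {(x, y). dist x y < e})"
definition open_ell2 :: "'a ell2 set \<Rightarrow> bool" where
  "open_ell2 S = (\<forall>x\<in>S. \<forall>\<^sub>F (x', y) in uniformity. x' = x \<longrightarrow> y \<in> S)"
instance
proof
  fix x y z :: "'a ell2" and r :: real
  show "inner x y = inner y x"
    unfolding inner_ell2_def by (subst cinner_commute) simp
  show "inner (x + y) z = inner x z + inner y z"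
    by (simp add: inner_ell2_def cinner_add_left)
  show "inner (r *\<^sub>R x) y = r * inner x y"
    by (simp add: inner_ell2_def scaleR_scaleC_ell2 cinner_scaleC_left)
  show "0 \<le> inner x x"
    by (simp add: inner_ell2_def cinner_self infsum_nonneg)
  show "inner x x = 0 \<longleftrightarrow> x = 0"
  proof
    assume "inner x x = 0"
    then have "(\<Sum>\<^sub>\<infinity>i. (cmod (coord x i))\<^sup>2) \<le> 0"
      by (simp add: inner_ell2_def cinner_self)
    then have "(cmod (coord x i))\<^sup>2 = 0" for i
      by (rule nonneg_infsum_le_0D) (simp_all add: coord_summable)
    then show "x = 0"
      by (intro ell2_eqI) simp
  qed (simp add: inner_ell2_def cinner_def)
  show "norm x = sqrt (inner x x)"
    by (simp add: inner_ell2_def norm_ell2_def cinner_self)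
qed (simp_all add: dist_ell2_def sgn_ell2_def uniformity_ell2_def open_ell2_def)
end

lemma norm_ell2_square: "(norm (x :: 'i ell2))\<^sup>2 = (\<Sum>\<^sub>\<infinity>i. (cmod (coord x i))\<^sup>2)"
  by (simp add: norm_ell2_def infsum_nonneg)

lemma cinner_self_norm: "cinner x x = complex_of_real ((norm x)\<^sup>2)"
  by (simp only: cinner_self norm_ell2_square)

lemma norm_scaleC_ell2: "norm (c *\<^sub>C x :: 'i ell2) = cmod c * norm x"
proof -
  have "(norm (c *\<^sub>C x))\<^sup>2 = (cmod c * norm x)\<^sup>2"
    using coord_summable[of x] unfolding power_mult_distrib norm_ell2_square
    by (simp add: norm_mult power_mult_distrib infsum_cmult_right)
  then show ?thesis
    by simp
qed

lemma bounded_linear_scaleC_ell2: "bounded_linear (\<lambda>x :: 'i ell2. c *\<^sub>C x)"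
  by (rule bounded_linear_intro[where K = "cmod c"])
    (auto intro!: ell2_eqI simp: algebra_simps norm_scaleC_ell2)

lemma finite_coord_sum_le: "finite F \<Longrightarrow> (\<Sum>i\<in>F. (cmod (coord x i))\<^sup>2) \<le> (norm x)\<^sup>2"
  unfolding norm_ell2_square by (rule finite_sum_le_infsum[OF coord_summable]) simp_all

lemma cmod_coord_le: "cmod (coord x i) \<le> norm x"
  using finite_coord_sum_le[of "{i}" x] by (simp add: power2_le_iff_abs_le)

lemma ell2_bounded_sumsI:
  assumes "\<And>F. finite F \<Longrightarrow> (\<Sum>i\<in>F. (cmod (f i))\<^sup>2) \<le> c\<^sup>2" "0 \<le> c"
  shows "coord (ell2_of f) = f" "norm (ell2_of f) \<le> c"
proof -
  have s: "(\<lambda>i. (cmod (f i))\<^sup>2) summable_on UNIV"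
    by (rule nonneg_bdd_above_summable_on) (auto intro!: bdd_aboveI2 assms(1))
  then show *: "coord (ell2_of f) = f"
    by (simp add: ell2_of_inverse)
  have "(norm (ell2_of f))\<^sup>2 \<le> c\<^sup>2"
    unfolding norm_ell2_square * by (rule infsum_le_finite_sums[OF s assms(1)])
  then show "norm (ell2_of f) \<le> c"
    using assms(2) by (rule power2_le_imp_le)
qed

instance ell2 :: (type) banach
proof
  fix X :: "nat \<Rightarrow> 'a ell2"
  assume X: "Cauchy X"
  have "Cauchy (\<lambda>n. coord (X n) i)" for i
  proof (rule CauchyI)
    fix e :: real
    assume "0 < e"
    then obtain M where M: "\<And>m n. m \<ge> M \<Longrightarrow> n \<ge> M \<Longrightarrow> norm (X m - X n) < e"
      using CauchyD[OF X] by blast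
    show "\<exists>M. \<forall>m\<ge>M. \<forall>n\<ge>M. norm (coord (X m) i - coord (X n) i) < e"
      using M cmod_coord_le[of "X _ - X _" i, simplified] by (meson le_less_trans)
  qed
  then have "\<exists>l. (\<lambda>n. coord (X n) i) \<longlonglongrightarrow> l" for i
    using Cauchy_convergent convergent_def by blast
  then obtain l where l: "\<And>i. (\<lambda>n. coord (X n) i) \<longlonglongrightarrow> l i"
    by metis
  have tail: "(\<Sum>i\<in>F. (cmod (coord (X n) i - l i))\<^sup>2) \<le> e\<^sup>2"
    if F: "finite F" and M: "\<And>m n. m \<ge> M \<Longrightarrow> n \<ge> M \<Longrightarrow> norm (X m - X n) < e" and n: "n \<ge> M"
    for F M e n
  proof (rule LIMSEQ_le_const2)
    show "(\<lambda>m. \<Sum>i\<in>F. (cmod (coord (X n) i - coord (X m) i))\<^sup>2)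
        \<longlonglongrightarrow> (\<Sum>i\<in>F. (cmod (coord (X n) i - l i))\<^sup>2)"
      by (intro tendsto_intros l)
    show "\<exists>N. \<forall>m\<ge>N. (\<Sum>i\<in>F. (cmod (coord (X n) i - coord (X m) i))\<^sup>2) \<le> e\<^sup>2"
    proof (intro exI allI impI)
      fix m assume "m \<ge> M"
      have "(\<Sum>i\<in>F. (cmod (coord (X n) i - coord (X m) i))\<^sup>2) \<le> (norm (X n - X m))\<^sup>2"
        using finite_coord_sum_le[OF F, of "X n - X m"] by simp
      also have "\<dots> \<le> e\<^sup>2"
        using M[OF n \<open>m \<ge> M\<close>] by (intro power_mono) simp_all
      finally show "(\<Sum>i\<in>F. (cmod (coord (X n) i - coord (X m) i))\<^sup>2) \<le> e\<^sup>2" .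
    qed
  qed
  have near: "\<exists>y. coord y = (\<lambda>i. coord (X n) i - l i) \<and> norm y \<le> e"
    if M: "\<And>m n. m \<ge> M \<Longrightarrow> n \<ge> M \<Longrightarrow> norm (X m - X n) < e" and n: "n \<ge> M" and e: "0 < e"
    for M e n
    using ell2_bounded_sumsI[of "\<lambda>i. coord (X n) i - l i" e] tail[OF _ M n] e by auto
  obtain M1 where M1: "\<And>m n. m \<ge> M1 \<Longrightarrow> n \<ge> M1 \<Longrightarrow> norm (X m - X n) < 1"
    using CauchyD[OF X, of 1] by auto
  obtain y where y: "coord y = (\<lambda>i. coord (X M1) i - l i)"
    using near[OF M1, of M1] by auto
  define L where "L = X M1 - y"
  have L: "coord L = l"
    by (simp add: L_def y fun_eq_iff)
  have "X \<longlonglongrightarrow> L"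
  proof (rule LIMSEQ_I)
    fix r :: real
    assume r: "0 < r"
    then obtain M where M: "\<And>m n. m \<ge> M \<Longrightarrow> n \<ge> M \<Longrightarrow> norm (X m - X n) < r / 2"
      using CauchyD[OF X, of "r / 2"] by auto
    show "\<exists>no. \<forall>n\<ge>no. norm (X n - L) < r"
    proof (intro exI allI impI)
      fix n assume "n \<ge> M"
      then obtain z where z: "coord z = (\<lambda>i. coord (X n) i - l i)" "norm z \<le> r / 2"
        using near[OF M, of n] r by auto
      have "z = X n - L"
        by (rule ell2_eqI) (simp add: z L)
      then show "norm (X n - L) < r"
        using z r by simp
    qed
  qed
  then show "convergent X"
    by (rule convergentI)
qed

lift_definition ket :: "'i \<Rightarrow> 'i ell2" is "\<lambda>j i. if i = j then 1 else 0"
  by (rule finite_nonzero_values_imp_summable_on) (auto intro: finite_subset[of _ "{_}"])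

lemma coord_ket: "coord (ket j) i = (if i = j then 1 else 0)"
  by (rule fun_cong[OF ket.rep_eq])

lemma coord_sum: "coord (\<Sum>j\<in>F. f j) i = (\<Sum>j\<in>F. coord (f j) i)"
  by (induction F rule: infinite_finite_induct) simp_all

lemma coord_sum_ket: "finite F \<Longrightarrow> coord (\<Sum>j\<in>F. c j *\<^sub>C ket j) i = (if i \<in> F then c i else 0)"
  by (simp add: coord_sum coord_ket if_distrib[of "(*) _"] cong: if_cong)

lemma norm_sum_ket: "finite F \<Longrightarrow> (norm (\<Sum>j\<in>F. c j *\<^sub>C ket j))\<^sup>2 = (\<Sum>j\<in>F. (cmod (c j))\<^sup>2)"
  unfolding norm_ell2_square
  by (subst infsum_cong_neutral[where T = F and g = "\<lambda>j. (cmod (c j))\<^sup>2"]) (auto simp: coord_sum_ket)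

lemma ket_approx:
  assumes "0 < e"
  shows "\<exists>F. finite F \<and> norm (x - (\<Sum>j\<in>F. coord x j *\<^sub>C ket j)) < e"
proof -
  let ?f = "\<lambda>i. (cmod (coord x i))\<^sup>2"
  have "0 < e\<^sup>2 / 2"
    using assms by simp
  from infsum_finite_approximation[OF coord_summable[of x] this]
  obtain F where F: "finite F" "dist (sum ?f F) (infsum ?f UNIV) \<le> e\<^sup>2 / 2"
    by blast
  let ?y = "\<Sum>j\<in>F. coord x j *\<^sub>C ket j"
  have "(norm (x - ?y))\<^sup>2 = infsum ?f (UNIV - F)"
    unfolding norm_ell2_square by (rule infsum_cong_neutral) (auto simp: coord_sum_ket F)
  also have "\<dots> = infsum ?f UNIV - sum ?f F"
    using F by (subst infsum_Diff) (auto intro: coord_summable)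
  also have "\<dots> \<le> e\<^sup>2 / 2"
    using F(2) unfolding dist_real_def by linarith
  also have "\<dots> < e\<^sup>2"
    using assms by simp
  finally have "norm (x - ?y) < e"
    by (rule power2_less_imp_less) (use assms in simp)
  then show ?thesis
    using F by blast
qed

lemma Re_cinner: "Re (cinner x y) = inner x y"
  by (simp add: inner_ell2_def)

lemma Im_cinner: "Im (cinner x y) = inner ((- \<i>) *\<^sub>C x) y"
  by (simp add: inner_ell2_def cinner_scaleC_left)

lemma cinner_ket_left: "cinner (ket j) y = cnj (coord y j)"
proof -
  have "cinner (ket j) y = (\<Sum>\<^sub>\<infinity>i\<in>{j}. cnj (coord y i))"
    unfolding cinner_def by (rule infsum_cong_neutral) (auto simp: coord_ket)
  then show ?thesis
    by simp
qed

lemma cinner_sum_left: "cinner (\<Sum>j\<in>F. f j) y = (\<Sum>j\<in>F. cinner (f j) y)"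
proof (induction F rule: infinite_finite_induct)
qed (simp_all add: cinner_add_left, simp_all add: cinner_def)


section \<open>The C*-algebra of bounded operators\<close>

text \<open>
  The library type of bounded real-linear maps provides the operator norm; the bounded
  operators on the complex Hilbert space are its complex-linear elements.
\<close>

typedef 'i ell2_op =
  "{T :: 'i ell2 \<Rightarrow>\<^sub>L 'i ell2. \<forall>c x. blinfun_apply T (c *\<^sub>C x) = c *\<^sub>C blinfun_apply T x}"
  morphisms blinfun_of_op op_of_blinfun
  by (rule exI[of _ 0]) (auto intro: ell2_eqI)

setup_lifting type_definition_ell2_op

definition op_apply :: "'i ell2_op \<Rightarrow> 'i ell2 \<Rightarrow> 'i ell2" where
  "op_apply T = blinfun_apply (blinfun_of_op T)"

lemma bounded_linear_op_apply: "bounded_linear (op_apply T)"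
  by (simp add: op_apply_def blinfun.bounded_linear_right)

lemma op_apply_scaleC: "op_apply T (c *\<^sub>C x) = c *\<^sub>C op_apply T x"
  using blinfun_of_op[of T] by (simp add: op_apply_def)

lemma op_eqI: "(\<And>x. op_apply S x = op_apply T x) \<Longrightarrow> S = T"
  by (simp add: op_apply_def blinfun_of_op_inject[symmetric] blinfun_eqI)

lemma op_apply_add: "op_apply T (x + y) = op_apply T x + op_apply T y"
  by (simp add: op_apply_def blinfun.add_right)

lemma op_apply_sum: "op_apply T (\<Sum>j\<in>F. f j) = (\<Sum>j\<in>F. op_apply T (f j))"
  by (simp add: op_apply_def blinfun.sum_right)

instantiation ell2_op :: (type) "{real_vector, monoid_mult}"
begin
lift_definition zero_ell2_op :: "'a ell2_op" is 0
  by (auto intro: ell2_eqI)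
lift_definition one_ell2_op :: "'a ell2_op" is id_blinfun
  by simp
lift_definition plus_ell2_op :: "'a ell2_op \<Rightarrow> 'a ell2_op \<Rightarrow> 'a ell2_op" is "(+)"
  by (auto intro: ell2_eqI simp: blinfun.bilinear_simps algebra_simps)
lift_definition uminus_ell2_op :: "'a ell2_op \<Rightarrow> 'a ell2_op" is uminus
  by (auto intro: ell2_eqI simp: blinfun.bilinear_simps)
lift_definition minus_ell2_op :: "'a ell2_op \<Rightarrow> 'a ell2_op \<Rightarrow> 'a ell2_op" is "(-)"
  by (auto intro: ell2_eqI simp: blinfun.bilinear_simps algebra_simps)
lift_definition scaleR_ell2_op :: "real \<Rightarrow> 'a ell2_op \<Rightarrow> 'a ell2_op" is scaleR
  by (auto intro: ell2_eqI simp: blinfun.bilinear_simps)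
lift_definition times_ell2_op :: "'a ell2_op \<Rightarrow> 'a ell2_op \<Rightarrow> 'a ell2_op" is blinfun_compose
  by simp
instance
  by standard
    (transfer; auto intro!: blinfun_eqI simp: blinfun.bilinear_simps algebra_simps)+
end

instantiation ell2_op :: (type) real_normed_algebra
begin
lift_definition norm_ell2_op :: "'a ell2_op \<Rightarrow> real" is norm .
definition dist_ell2_op :: "'a ell2_op \<Rightarrow> 'a ell2_op \<Rightarrow> real" where
  "dist_ell2_op S T = norm (S - T)"
definition sgn_ell2_op :: "'a ell2_op \<Rightarrow> 'a ell2_op" where
  "sgn_ell2_op T = T /\<^sub>R norm T"
definition uniformity_ell2_op :: "('a ell2_op \<times> 'a ell2_op) filter" where
  "uniformity_ell2_op = (INF e\<in>{0 <..}. principal {(x, y). dist x y < e})"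
definition open_ell2_op :: "'a ell2_op set \<Rightarrow> bool" where
  "open_ell2_op S = (\<forall>x\<in>S. \<forall>\<^sub>F (x', y) in uniformity. x' = x \<longrightarrow> y \<in> S)"
instance
proof
  fix S T U :: "'a ell2_op" and r :: real
  show "(S + T) * U = S * U + T * U" "S * (T + U) = S * T + S * U"
    "r *\<^sub>R S * T = r *\<^sub>R (S * T)" "S * r *\<^sub>R T = r *\<^sub>R (S * T)"
    by (transfer; auto intro!: blinfun_eqI simp: blinfun.bilinear_simps)+
  show "norm T = 0 \<longleftrightarrow> T = 0" "norm (S + T) \<le> norm S + norm T" "norm (r *\<^sub>R T) = \<bar>r\<bar> * norm T"
    "norm (S * T) \<le> norm S * norm T"
    by (transfer; simp add: norm_triangle_ineq norm_blinfun_compose)+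
qed (simp_all add: dist_ell2_op_def sgn_ell2_op_def uniformity_ell2_op_def open_ell2_op_def)
end

instance ell2_op :: (type) banach
proof
  fix X :: "nat \<Rightarrow> 'a ell2_op"
  have dist: "dist (blinfun_of_op S) (blinfun_of_op T) = dist S T" for S T :: "'a ell2_op"
    by (simp add: dist_norm norm_ell2_op.rep_eq minus_ell2_op.rep_eq)
  assume "Cauchy X"
  then have "Cauchy (\<lambda>n. blinfun_of_op (X n))"
    by (simp add: Cauchy_def dist)
  then obtain T where T: "(\<lambda>n. blinfun_of_op (X n)) \<longlonglongrightarrow> T"
    using Cauchy_convergent convergent_def by blast
  have lim: "(\<lambda>n. op_apply (X n) x) \<longlonglongrightarrow> blinfun_apply T x" for x
    unfolding op_apply_def by (intro tendsto_intros T)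
  have "blinfun_apply T (c *\<^sub>C x) = c *\<^sub>C blinfun_apply T x" for c x
  proof (rule LIMSEQ_unique[OF lim])
    show "(\<lambda>n. op_apply (X n) (c *\<^sub>C x)) \<longlonglongrightarrow> c *\<^sub>C blinfun_apply T x"
      unfolding op_apply_scaleC by (rule bounded_linear.tendsto[OF bounded_linear_scaleC_ell2 lim])
  qed
  then have "blinfun_of_op (op_of_blinfun T) = T"
    by (simp add: op_of_blinfun_inverse)
  then have "X \<longlonglongrightarrow> op_of_blinfun T"
    using T unfolding tendsto_iff by (metis (no_types, lifting) dist eventually_mono)
  then show "convergent X"
    by (rule convergentI)
qed

lemma op_apply_simps [simp]:
  "op_apply 1 x = x"
  "op_apply (S + T) x = op_apply S x + op_apply T x"
  "op_apply (r *\<^sub>R T) x = r *\<^sub>R op_apply T x"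
  "op_apply (S * T) x = op_apply S (op_apply T x)"
  by (simp_all add: op_apply_def one_ell2_op.rep_eq plus_ell2_op.rep_eq
      scaleR_ell2_op.rep_eq times_ell2_op.rep_eq blinfun.bilinear_simps)

lemma norm_op_apply: "norm (op_apply T x) \<le> norm T * norm x"
  by (simp add: op_apply_def norm_ell2_op.rep_eq norm_blinfun)

lemma norm_op_bound: "0 \<le> b \<Longrightarrow> (\<And>x. norm (op_apply T x) \<le> b * norm x) \<Longrightarrow> norm T \<le> b"
  by (simp add: op_apply_def norm_ell2_op.rep_eq norm_blinfun_bound)

lemma op_ofI:
  fixes f :: "'i ell2 \<Rightarrow> 'i ell2"
  assumes "\<And>x y. f (x + y) = f x + f y" "\<And>c x. f (c *\<^sub>C x) = c *\<^sub>C f x"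
    "\<And>x. norm (f x) \<le> K * norm x"
  shows "\<exists>T. op_apply T = f"
proof -
  have "bounded_linear f"
    using assms by (intro bounded_linear_intro[where K = K])
      (auto simp: scaleR_scaleC_ell2 mult.commute)
  then have "op_apply (op_of_blinfun (Blinfun f)) = f"
    using assms(2) by (simp add: op_apply_def op_of_blinfun_inverse bounded_linear_Blinfun_apply)
  then show ?thesis ..
qed

lemma adjoint_exists: "\<exists>S. \<forall>x y. cinner (op_apply T x) y = cinner x (op_apply S y)"
proof -
  have "\<exists>z. norm z \<le> norm T * norm y \<and> (\<forall>x. cinner (op_apply T x) y = cinner x z)" for y
  proof -
    define f where "f i = cnj (cinner (op_apply T (ket i)) y)" for i
    have bound: "(\<Sum>i\<in>F. (cmod (f i))\<^sup>2) \<le> (norm T * norm y)\<^sup>2" if F: "finite F" for F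
    proof -
      define u where "u = (\<Sum>i\<in>F. f i *\<^sub>C ket i)"
      have "cinner (op_apply T u) y = (\<Sum>i\<in>F. f i * cnj (f i))"
        by (simp add: u_def op_apply_sum op_apply_scaleC cinner_sum_left cinner_scaleC_left f_def)
      also have "\<dots> = complex_of_real (\<Sum>i\<in>F. (cmod (f i))\<^sup>2)"
        by (simp only: of_real_sum complex_norm_square)
      also have "\<dots> = complex_of_real ((norm u)\<^sup>2)"
        by (simp add: u_def norm_sum_ket F)
      finally have "(norm u)\<^sup>2 = inner (op_apply T u) y"
        by (simp flip: Re_cinner)
      also have "\<dots> \<le> norm (op_apply T u) * norm y"
        by (rule norm_cauchy_schwarz)
      also have "\<dots> \<le> (norm T * norm u) * norm y"
        by (intro mult_right_mono norm_op_apply) simp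
      finally have "norm u * norm u \<le> norm u * (norm T * norm y)"
        by (simp add: power2_eq_square mult_ac)
      then have "norm u \<le> norm T * norm y"
        by (cases "norm u = 0") simp_all
      then have "(norm u)\<^sup>2 \<le> (norm T * norm y)\<^sup>2"
        by (rule power_mono) simp
      then show ?thesis
        by (simp add: u_def norm_sum_ket F)
    qed
    define z where "z = ell2_of f"
    have z: "coord z = f" "norm z \<le> norm T * norm y"
      unfolding z_def using ell2_bounded_sumsI[OF bound] by simp_all
    have re: "inner (op_apply T x) y = inner x z" for x
    proof -
      let ?S = "{x. inner (op_apply T x) y = inner x z}"
      have "closed ?S"
        by (intro closed_Collect_eq continuous_intros
            bounded_linear.continuous_on[OF bounded_linear_op_apply])
      moreover have "\<exists>w\<in>?S. dist w x < e" if e: "0 < e" for e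
      proof -
        obtain F where F: "finite F" "norm (x - (\<Sum>j\<in>F. coord x j *\<^sub>C ket j)) < e"
          using ket_approx[OF e] by blast
        have "cinner (op_apply T (\<Sum>j\<in>F. coord x j *\<^sub>C ket j)) y
            = cinner (\<Sum>j\<in>F. coord x j *\<^sub>C ket j) z"
          by (simp add: op_apply_sum op_apply_scaleC cinner_sum_left cinner_scaleC_left
              cinner_ket_left z f_def)
        then have "(\<Sum>j\<in>F. coord x j *\<^sub>C ket j) \<in> ?S"
          by (simp flip: Re_cinner)
        then show ?thesis
          using F by (auto simp: dist_norm norm_minus_commute)
      qed
      ultimately have "x \<in> ?S"
        using closed_approachable by blast
      then show ?thesis
        by simp
    qed
    have "cinner (op_apply T x) y = cinner x z" for x
      by (rule complex_eqI) (simp_all add: Re_cinner Im_cinner re flip: op_apply_scaleC)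
    then show ?thesis
      using z by blast
  qed
  then obtain f where f: "\<And>y. norm (f y) \<le> norm T * norm y"
      "\<And>x y. cinner (op_apply T x) y = cinner x (f y)"
    by metis
  have coord_f: "coord (f y) i = cinner y (op_apply T (ket i))" for y i
    using f(2)[of "ket i" y] by (subst cinner_commute) (simp add: cinner_ket_left)
  have "\<exists>S. op_apply S = f"
    by (rule op_ofI[OF _ _ f(1)])
      (auto intro!: ell2_eqI simp: coord_f cinner_add_left cinner_scaleC_left)
  then show ?thesis
    using f by metis
qed

lemma cinner_left_eqI: "(\<And>x. cinner x y = cinner x z) \<Longrightarrow> y = z"
  by (rule ell2_eqI) (metis cinner_ket_left complex_cnj_cancel_iff)

lemma adjoint_unique:
  assumes "\<And>x y. cinner (op_apply T x) y = cinner x (op_apply S y)"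
    and "\<And>x y. cinner (op_apply T x) y = cinner x (op_apply S' y)"
  shows "S = S'"
  by (intro op_eqI cinner_left_eqI) (use assms in metis)

definition scaleC_blinfun :: "complex \<Rightarrow> 'i ell2 \<Rightarrow>\<^sub>L 'i ell2" where
  "scaleC_blinfun c = Blinfun (\<lambda>x. c *\<^sub>C x)"

lemma scaleC_blinfun_apply [simp]: "blinfun_apply (scaleC_blinfun c) x = c *\<^sub>C x"
  by (simp add: scaleC_blinfun_def bounded_linear_Blinfun_apply bounded_linear_scaleC_ell2)

instantiation ell2_op :: (type) scaleC
begin
lift_definition scaleC_ell2_op :: "complex \<Rightarrow> 'a ell2_op \<Rightarrow> 'a ell2_op" is
  "\<lambda>c T. scaleC_blinfun c o\<^sub>L T"
  by (auto intro!: ell2_eqI)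
instance ..
end

instantiation ell2_op :: (type) unital_cstar_algebra
begin

definition star_ell2_op :: "'a ell2_op \<Rightarrow> 'a ell2_op" where
  "star_ell2_op T = (THE S. \<forall>x y. cinner (op_apply T x) y = cinner x (op_apply S y))"

lemma op_apply_scaleC_op: "op_apply (c *\<^sub>C T) x = c *\<^sub>C op_apply T x" for T :: "'a ell2_op"
  by (simp add: op_apply_def scaleC_ell2_op.rep_eq)

lemma cinner_star: "cinner (op_apply T x) y = cinner x (op_apply (star T) y)" for T :: "'a ell2_op"
proof -
  have "\<exists>!S. \<forall>x y. cinner (op_apply T x) y = cinner x (op_apply S y)"
    using adjoint_exists[of T] adjoint_unique[of T] by blast
  from theI'[OF this] show ?thesis
    unfolding star_ell2_op_def by blast
qed

lemma star_eqI:
  "(\<And>x y. cinner (op_apply T x) y = cinner x (op_apply S y)) \<Longrightarrow> star T = S" for S T :: "'a ell2_op"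
  by (rule adjoint_unique[OF cinner_star])

instance
proof
  have cinner_add_right: "cinner x (y + z) = cinner x y + cinner x z" for x y z :: "'a ell2"
    by (subst (1 2 3) cinner_commute) (simp add: cinner_add_left)
  have cinner_scaleC_right: "cinner x (c *\<^sub>C y) = cnj c * cinner x y" for c and x y :: "'a ell2"
    by (subst (1 2) cinner_commute) (simp add: cinner_scaleC_left)
  fix S T :: "'a ell2_op" and a b :: complex and r :: real
  show "complex_of_real r *\<^sub>C T = r *\<^sub>R T" "(a + b) *\<^sub>C T = a *\<^sub>C T + b *\<^sub>C T"
    "a *\<^sub>C (S + T) = a *\<^sub>C S + a *\<^sub>C T" "a *\<^sub>C (b *\<^sub>C T) = (a * b) *\<^sub>C T"
    "a *\<^sub>C S * T = a *\<^sub>C (S * T)" "S * a *\<^sub>C T = a *\<^sub>C (S * T)"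
    by (auto intro!: op_eqI ell2_eqI simp: op_apply_scaleC_op op_apply_scaleC algebra_simps)
  show "star (star T) = T"
    by (rule star_eqI) (metis cinner_commute cinner_star)
  show "star (S + T) = star S + star T"
    by (rule star_eqI) (simp add: cinner_add_left cinner_add_right cinner_star)
  show "star (a *\<^sub>C T) = cnj a *\<^sub>C star T"
    by (rule star_eqI)
      (simp add: op_apply_scaleC_op cinner_scaleC_left cinner_scaleC_right cinner_star)
  show "star (S * T) = star T * star S"
    by (rule star_eqI) (simp add: cinner_star)
  have le: "norm (c *\<^sub>C U) \<le> cmod c * norm U" for c and U :: "'a ell2_op"
    by (rule norm_op_bound)
      (auto simp: op_apply_scaleC_op norm_scaleC_ell2 mult.assoc intro!: mult_left_mono norm_op_apply)
  show "norm (a *\<^sub>C T) = cmod a * norm T"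
  proof (cases "a = 0")
    case True
    then show ?thesis
      using le[of 0 T] by simp
  next
    case False
    have "T = inverse a *\<^sub>C (a *\<^sub>C T)"
      using False by (auto intro!: op_eqI ell2_eqI simp: op_apply_scaleC_op)
    then have "norm T \<le> inverse (cmod a) * norm (a *\<^sub>C T)"
      using le[of "inverse a" "a *\<^sub>C T"] by (simp add: norm_inverse)
    then have "cmod a * norm T \<le> norm (a *\<^sub>C T)"
      using False by (simp add: field_simps)
    then show ?thesis
      using le[of a T] by simp
  qed
  have ge: "(norm U)\<^sup>2 \<le> norm (star U * U)" for U :: "'a ell2_op"
  proof -
    have "norm U \<le> sqrt (norm (star U * U))"
    proof (rule norm_op_bound)
      fix x
      have "(norm (op_apply U x))\<^sup>2 = inner (op_apply U x) (op_apply U x)"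
        by (simp add: power2_norm_eq_inner)
      also have "\<dots> = inner x (op_apply (star U * U) x)"
        by (simp add: cinner_star flip: Re_cinner)
      also have "\<dots> \<le> norm x * norm (op_apply (star U * U) x)"
        by (rule norm_cauchy_schwarz)
      also have "\<dots> \<le> norm x * (norm (star U * U) * norm x)"
        by (intro mult_left_mono norm_op_apply) simp
      also have "\<dots> = (sqrt (norm (star U * U)) * norm x)\<^sup>2"
        by (simp add: power_mult_distrib) (simp add: power2_eq_square)
      finally show "norm (op_apply U x) \<le> sqrt (norm (star U * U)) * norm x"
        by (rule power2_le_imp_le) simp
    qed simp
    then have "(norm U)\<^sup>2 \<le> (sqrt (norm (star U * U)))\<^sup>2"
      by (rule power_mono) simp
    then show ?thesis
      by simp
  qed
  have star_le: "norm U \<le> norm (star U)" for U :: "'a ell2_op"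
  proof -
    have "norm U * norm U \<le> norm (star U) * norm U"
      using ge[of U] norm_mult_ineq[of "star U" U] by (simp add: power2_eq_square)
    then show ?thesis
      by (cases "norm U = 0") auto
  qed
  have "norm (star T) \<le> norm T"
    using star_le[of "star T"] \<open>star (star T) = T\<close> by simp
  then have "norm (star T * T) \<le> (norm T)\<^sup>2"
    using norm_mult_ineq[of "star T" T] mult_right_mono[of "norm (star T)" "norm T" "norm T"]
    by (simp add: power2_eq_square)
  then show "norm (star T * T) = (norm T)\<^sup>2"
    using ge[of T] by simp
qed

end


section \<open>Left regular representation\<close>

lift_definition translate :: "'i::cancel_comm_monoid_add \<Rightarrow> 'i ell2 \<Rightarrow> 'i ell2" is
  "\<lambda>p f r. if r \<in> range ((+) p) then f (inv ((+) p) r) else 0"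
proof -
  fix p :: 'i and f :: "'i \<Rightarrow> complex"
  let ?g = "\<lambda>r. if r \<in> range ((+) p) then f (inv ((+) p) r) else 0"
  assume "(\<lambda>i. (cmod (f i))\<^sup>2) summable_on UNIV"
  then have "(\<lambda>r. (cmod (?g r))\<^sup>2) summable_on range ((+) p)"
    by (subst summable_on_reindex) (simp_all add: o_def)
  then show "(\<lambda>r. (cmod (?g r))\<^sup>2) summable_on UNIV"
    by (rule summable_on_cong_neutral[THEN iffD1, rotated -1]) auto
qed

lemma norm_translate: "norm (translate p x) = norm x"
proof -
  have "(\<Sum>\<^sub>\<infinity>i. (cmod (coord (translate p x) i))\<^sup>2)
      = (\<Sum>\<^sub>\<infinity>i\<in>range ((+) p). (cmod (coord (translate p x) i))\<^sup>2)"
    by (rule infsum_cong_neutral) (auto simp: translate.rep_eq)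
  also have "\<dots> = (\<Sum>\<^sub>\<infinity>i. (cmod (coord x i))\<^sup>2)"
    by (subst infsum_reindex) (simp_all add: o_def translate.rep_eq)
  finally show ?thesis
    by (simp add: norm_ell2_def)
qed

definition left_shift :: "'i::cancel_comm_monoid_add \<Rightarrow> 'i ell2_op" where
  "left_shift p = (THE T. op_apply T = translate p)"

lemma op_apply_left_shift: "op_apply (left_shift p) = translate p"
proof -
  have "\<exists>T. op_apply T = translate p"
    by (rule op_ofI[where K = 1])
      (auto intro!: ell2_eqI simp: norm_translate translate.rep_eq)
  then have "\<exists>!T. op_apply T = translate p"
    by (metis op_eqI)
  from theI'[OF this] show ?thesis
    by (simp add: left_shift_def)
qed

lemma left_shift_ket: "op_apply (left_shift p) (ket q) = ket (p + q)"
  by (rule ell2_eqI) (auto simp: op_apply_left_shift translate.rep_eq coord_ket)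

definition reduced_toeplitz :: "'i::cancel_comm_monoid_add ell2_op set" where
  "reduced_toeplitz = cstar_generated (range left_shift)"


section \<open>The numerical semigroup and the Toeplitz relations\<close>

definition Sig :: "int set" where
  "Sig = {n. 0 \<le> n \<and> n \<noteq> 1}"

typedef sig = Sig
  morphisms int_of_sig sig_of_int
  by (rule exI[of _ 0]) (simp add: Sig_def)

setup_lifting type_definition_sig

instantiation sig :: cancel_comm_monoid_add
begin
lift_definition zero_sig :: sig is 0
  by (simp add: Sig_def)
lift_definition plus_sig :: "sig \<Rightarrow> sig \<Rightarrow> sig" is "(+)"
  by (auto simp: Sig_def)
text \<open>
  The type class demands a subtraction; it is not used below.
\<close>
lift_definition minus_sig :: "sig \<Rightarrow> sig \<Rightarrow> sig" is
  "\<lambda>m n. if m - n \<in> Sig then m - n else 0"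
  by (auto simp: Sig_def)
instance
  by standard (transfer; auto simp: Sig_def)+
end

text \<open>
  A word of even length \<open>2k\<close> is represented by the list of its \<open>k\<close> consecutive pairs
  \<open>[(p\<^sub>1, p\<^sub>2), (p\<^sub>3, p\<^sub>4), \<dots>]\<close>.
\<close>
type_synonym word = "(sig \<times> sig) list"

definition neutral :: "word \<Rightarrow> bool" where
  "neutral \<alpha> \<longleftrightarrow> (\<Sum>(p, q)\<leftarrow>\<alpha>. - int_of_sig p + int_of_sig q) = 0"

text \<open>
  Dropping the first \<open>j\<close> pairs and reading the rest from the right gives the shift
  \<open>-p\<^bsub>2k\<^esub> + p\<^bsub>2k-1\<^esub> - \<dots> - p\<^bsub>2j+2\<^esub> + p\<^bsub>2j+1\<^esub>\<close>.
\<close>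
definition K_set :: "word \<Rightarrow> int set" where
  "K_set \<alpha> = Sig \<inter> (\<Inter>j<length \<alpha>.
     (+) (\<Sum>(p, q)\<leftarrow>drop j \<alpha>. - int_of_sig q + int_of_sig p) ` Sig)"

definition word_prod :: "(sig \<Rightarrow> 'a::unital_cstar_algebra) \<Rightarrow> word \<Rightarrow> 'a" where
  "word_prod V \<alpha> = (\<Prod>(p, q)\<leftarrow>\<alpha>. star (V p) * V q)"

definition toeplitz_relations :: "(sig \<Rightarrow> 'a::unital_cstar_algebra) \<Rightarrow> bool" where
  "toeplitz_relations V \<longleftrightarrow>
     V 0 = 1 \<and>
     (\<forall>\<alpha>. neutral \<alpha> \<and> K_set \<alpha> = {} \<longrightarrow> word_prod V \<alpha> = 0) \<and>
     (\<forall>\<alpha> \<beta>. neutral \<alpha> \<and> neutral \<beta> \<and> K_set \<alpha> = K_set \<beta> \<longrightarrow> word_prod V \<alpha> = word_prod V \<beta>)"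

end

theory Submission
  imports Defs
begin

text \<open>
  Put \<open>P = V\<^sub>3\<^sup>*V\<^sub>2V\<^sub>2\<^sup>*V\<^sub>3\<close> and \<open>E = 1 - P\<close>. The relations make \<open>W = V\<^sub>2\<^sup>*V\<^sub>3 + V\<^sub>2E\<close> an isometry with
  range projection \<open>P\<close> that generates the same algebra as the \<open>V\<^sub>p\<close>; for the left regular representation
  \<open>W\<close> is a unilateral shift. So the claim is Coburn's theorem: if \<open>w\<close> is a non-unitary isometry and \<open>v\<close>
  any isometry, then \<open>w \<mapsto> v\<close> extends to a homomorphism, because \<open>\<parallel>p(v)\<parallel> \<le> \<parallel>p(w)\<parallel>\<close> for every
  *-polynomial \<open>p = \<Sum>\<^bsub>i,j<N\<^esub> c\<^sub>i\<^sub>j w\<^sup>i w\<^sup>*\<^sup>j\<close>. Indeed \<open>\<bar>c\<^sub>i\<^sub>j\<bar> \<le> 2 \<parallel>p(w)\<parallel>\<close>, hence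
  \<open>\<parallel>p(v)\<parallel> \<le> 2N\<^sup>2 \<parallel>p(w)\<parallel>\<close>, and applying this to the powers of \<open>p\<^sup>*p\<close> removes the factor. Homomorphisms are
  automatically contractive, so \<open>\<pi>\<close> is determined by its values on the generators.
\<close>

section \<open>Elementary facts on C*-algebras\<close>

lemma scaleC_minus_one [simp]: "(-1) *\<^sub>C x = - (x :: 'a::unital_cstar_algebra)"
  using scaleC_of_real[of "-1" x] by simp

lemma scaleC_zero_left [simp]: "0 *\<^sub>C x = (0 :: 'a::unital_cstar_algebra)"
  using scaleC_of_real[of 0 x] by simp

lemma scaleC_zero_right [simp]: "a *\<^sub>C 0 = (0 :: 'a::unital_cstar_algebra)"
  using norm_scaleC[of a "0 :: 'a"] by simp

lemma scaleC_one [simp]: "1 *\<^sub>C x = (x :: 'a::unital_cstar_algebra)"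
  using scaleC_of_real[of 1 x] by simp

lemma star_zero [simp]: "star 0 = (0 :: 'a::unital_cstar_algebra)"
  using star_scaleC[of 0 "0 :: 'a"] by simp

lemma star_minus: "star (- x) = - star (x :: 'a::unital_cstar_algebra)"
  using star_scaleC[of "-1" x] by simp

lemma scaleC_diff_right: "c *\<^sub>C (x - y) = c *\<^sub>C x - c *\<^sub>C (y :: 'a::unital_cstar_algebra)"
  using scaleC_add_right[of c x "(-1) *\<^sub>C y"] scaleC_scaleC[of c "-1" y] scaleC_scaleC[of "-1" c y] by simp

lemma star_diff: "star (x - y) = star x - star (y :: 'a::unital_cstar_algebra)"
  using star_add[of x "- y"] by (simp add: star_minus)

lemma star_one [simp]: "star 1 = (1 :: 'a::unital_cstar_algebra)"
  by (metis mult_1_right star_mult star_star)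

lemma star_power: "star (x ^ n) = star (x :: 'a::unital_cstar_algebra) ^ n"
  by (induction n) (simp_all add: star_mult power_commutes)

lemma norm_star: "norm (star x) = norm (x :: 'a::unital_cstar_algebra)"
proof -
  have le: "norm z \<le> norm (star z)" for z :: 'a
  proof -
    have "norm z * norm z \<le> norm (star z) * norm z"
      using norm_mult_ineq[of "star z" z] by (simp add: cstar_identity power2_eq_square)
    then show ?thesis
      by (cases "norm z = 0") auto
  qed
  show ?thesis
    using le[of x] le[of "star x"] by (simp add: star_star)
qed

lemma star_mult_eq_zeroD: "star x * x = 0 \<Longrightarrow> x = (0 :: 'a::unital_cstar_algebra)"
  using cstar_identity[of x] by simp

lemma scaleC_sum_right: "a *\<^sub>C (\<Sum>i\<in>F. f i) = (\<Sum>i\<in>F. a *\<^sub>C (f i :: 'a::unital_cstar_algebra))"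
  by (induction F rule: infinite_finite_induct) (simp_all add: scaleC_add_right)

lemma star_sum: "star (\<Sum>i\<in>F. f i) = (\<Sum>i\<in>F. star (f i :: 'a::unital_cstar_algebra))"
  by (induction F rule: infinite_finite_induct) (simp_all add: star_add)

lemma star_scaleR: "star (r *\<^sub>R x) = r *\<^sub>R star (x :: 'a::unital_cstar_algebra)"
  by (simp add: star_scaleC flip: scaleC_of_real)

lemma bounded_linear_star: "bounded_linear (star :: 'a::unital_cstar_algebra \<Rightarrow> 'a)"
  by (rule bounded_linear_intro[where K = 1]) (simp_all add: star_add star_scaleR norm_star)

lemma bounded_linear_scaleC: "bounded_linear (\<lambda>x :: 'a::unital_cstar_algebra. c *\<^sub>C x)"
  by (rule bounded_linear_intro[where K = "cmod c"])
    (simp_all add: scaleC_add_right norm_scaleC scaleC_scaleC mult.commute flip: scaleC_of_real)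

lemmas continuous_on_star [continuous_intros] = bounded_linear.continuous_on[OF bounded_linear_star]
lemmas continuous_on_scaleC [continuous_intros] = bounded_linear.continuous_on[OF bounded_linear_scaleC]

text \<open>The C*-identity becomes \<open>norm p = (norm p)\<^sup>2\<close>. The value 0 can occur
  even for \<open>p = 1\<close>, namely in the zero algebra.\<close>

lemma norm_projection:
  fixes p :: "'a::unital_cstar_algebra"
  assumes "star p = p" "p * p = p"
  shows "norm p = 0 \<or> norm p = 1"
  using cstar_identity[of p] assms by (simp add: power2_eq_square)

lemma norm_isometry_le_one:
  fixes w :: "'a::unital_cstar_algebra"
  assumes "star w * w = 1"
  shows "norm w \<le> 1"
proof -
  have "(norm w)\<^sup>2 \<le> 1\<^sup>2"
    using cstar_identity[of w] norm_projection[of "1 :: 'a"] assms by auto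
  then show ?thesis
    by (rule power2_le_imp_le) simp
qed

text \<open>Each doubling of the exponent is one use of the C*-identity, hence the exponents
  \<open>2 ^ k\<close>.\<close>

lemma norm_self_adjoint_power:
  fixes h :: "'a::unital_cstar_algebra"
  assumes "star h = h"
  shows "norm (h ^ 2 ^ k) = norm h ^ 2 ^ k"
proof (induction k)
  case (Suc k)
  have "norm (h ^ 2 ^ Suc k) = norm (star (h ^ 2 ^ k) * h ^ 2 ^ k)"
    by (simp add: star_power assms mult_2 flip: power_add)
  also have "\<dots> = norm h ^ 2 ^ Suc k"
    by (simp add: cstar_identity Suc mult.commute flip: power_mult)
  finally show ?case .
qed simp

section \<open>C*-subalgebras and generated C*-subalgebras\<close>

lemma cstar_subalgebraD:
  assumes "cstar_subalgebra B"
  shows "closed B" "0 \<in> B" "x \<in> B \<Longrightarrow> y \<in> B \<Longrightarrow> x + y \<in> B" "x \<in> B \<Longrightarrow> y \<in> B \<Longrightarrow> x * y \<in> B"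
    "x \<in> B \<Longrightarrow> c *\<^sub>C x \<in> B" "x \<in> B \<Longrightarrow> star x \<in> B"
  using assms unfolding cstar_subalgebra_def by blast+

lemma cstar_subalgebra_diff:
  "cstar_subalgebra B \<Longrightarrow> x \<in> B \<Longrightarrow> y \<in> B \<Longrightarrow> x - y \<in> B"
  using cstar_subalgebraD(3)[of B x "(-1) *\<^sub>C y"] cstar_subalgebraD(5)[of B y "-1"] by simp

lemma cstar_subalgebra_scaleR:
  "cstar_subalgebra B \<Longrightarrow> x \<in> B \<Longrightarrow> r *\<^sub>R x \<in> B"
  by (metis cstar_subalgebraD(5) scaleC_of_real)

lemma cstar_subalgebra_generated: "cstar_subalgebra (cstar_generated S)"
  unfolding cstar_generated_def cstar_subalgebra_def by (auto intro!: closed_Inter)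

lemma cstar_generated_superset: "S \<subseteq> cstar_generated S"
  unfolding cstar_generated_def by blast

lemma cstar_generated_least: "cstar_subalgebra B \<Longrightarrow> S \<subseteq> B \<Longrightarrow> cstar_generated S \<subseteq> B"
  unfolding cstar_generated_def by blast

section \<open>Automatic continuity of homomorphisms\<close>

lemma star_homD:
  assumes "star_hom A B \<pi>"
  shows "x \<in> A \<Longrightarrow> \<pi> x \<in> B" "x \<in> A \<Longrightarrow> y \<in> A \<Longrightarrow> \<pi> (x + y) = \<pi> x + \<pi> y"
    "x \<in> A \<Longrightarrow> \<pi> (c *\<^sub>C x) = c *\<^sub>C \<pi> x" "x \<in> A \<Longrightarrow> y \<in> A \<Longrightarrow> \<pi> (x * y) = \<pi> x * \<pi> y"
    "x \<in> A \<Longrightarrow> \<pi> (star x) = star (\<pi> x)"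
  using assms unfolding star_hom_def by blast+

lemma star_hom_diff:
  assumes "star_hom A B \<pi>" "cstar_subalgebra A" "x \<in> A" "y \<in> A"
  shows "\<pi> (x - y) = \<pi> x - \<pi> y"
  using star_homD(2)[OF assms(1,3), of "(-1) *\<^sub>C y"] star_homD(3)[OF assms(1,4), of "-1"]
    cstar_subalgebraD(5)[OF assms(2,4), of "-1"] by simp

text \<open>
  The square root is \<open>1 - z\<close>, where \<open>z\<close> is the fixed point of the contraction
  \<open>z \<mapsto> (x + z\<^sup>2) / 2\<close> of the ball of radius \<open>\<parallel>x\<parallel>\<close>.
\<close>

lemma square_root_one_minus:
  fixes x k :: "'a::unital_cstar_algebra"
  assumes A: "cstar_subalgebra A" "1 \<in> A" "x \<in> A"
    and x: "star x = x" "x * k = k * x" "norm x < 1"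
  obtains c where "c \<in> A" "star c = c" "c * k = k * c" "c * c = 1 - x"
proof -
  \<comment> \<open>All properties wanted of \<open>z\<close> enter \<open>S\<close> as closed
    conditions, so the fixed point inherits them.\<close>
  define S where "S = A \<inter> {z. star z = z} \<inter> {z. z * k = k * z} \<inter> cball 0 (norm x)"
  define f where "f z = (1 / 2) *\<^sub>R (x + z * z)" for z
  have "\<exists>!z\<in>S. f z = z"
  proof (rule Banach_fix)
    show "complete S"
      unfolding S_def complete_eq_closed
      by (intro closed_Int closed_Collect_eq continuous_intros closed_cball cstar_subalgebraD[OF A(1)])
    show "S \<noteq> {}"
      unfolding S_def using cstar_subalgebraD(2)[OF A(1)] by (auto intro!: exI[of _ 0])
    show "f ` S \<subseteq> S"
    proof
      fix y assume "y \<in> f ` S"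
      then obtain z where z: "z \<in> A" "star z = z" "z * k = k * z" "norm z \<le> norm x" and y: "y = f z"
        unfolding S_def by auto
      have "norm (x + z * z) \<le> norm x + norm z * norm z"
        by (meson add_left_mono norm_mult_ineq norm_triangle_le)
      also have "\<dots> \<le> norm x + 1 * norm x"
        using z x by (intro add_left_mono mult_mono) auto
      finally have "norm y \<le> norm x"
        by (simp add: y f_def)
      moreover have "y * k = k * y"
      proof -
        have "z * z * k = k * (z * z)"
          by (metis mult.assoc z(3))
        then show ?thesis
          by (simp add: y f_def algebra_simps x)
      qed
      moreover have "star y = y"
        by (simp add: y f_def star_scaleR star_add star_mult z x)
      moreover have "y \<in> A"
        unfolding y f_def by (intro cstar_subalgebra_scaleR cstar_subalgebraD[OF A(1)] A z)
      ultimately show "y \<in> S"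
        unfolding S_def by simp
    qed
    show "dist (f z) (f w) \<le> norm x * dist z w" if "z \<in> S" "w \<in> S" for z w
    proof -
      have zw: "norm z \<le> norm x" "norm w \<le> norm x"
        using that by (auto simp: S_def)
      have "z * z - w * w = z * (z - w) + (z - w) * w"
        by (simp add: algebra_simps)
      then have "norm (z * z - w * w) \<le> norm z * norm (z - w) + norm (z - w) * norm w"
        by (metis add_mono norm_mult_ineq norm_triangle_le)
      also have "\<dots> \<le> norm x * norm (z - w) + norm (z - w) * norm x"
        using zw by (intro add_mono mult_mono) auto
      finally show ?thesis
        by (simp add: f_def dist_norm algebra_simps flip: scaleR_diff_right)
    qed
  qed (use x in auto)
  then obtain z where z: "z \<in> A" "star z = z" "z * k = k * z" "f z = z"
    unfolding S_def by auto
  show thesis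
  proof
    show "1 - z \<in> A"
      by (intro cstar_subalgebra_diff A z)
    show "star (1 - z) = 1 - z"
      by (simp add: star_diff z)
    show "(1 - z) * k = k * (1 - z)"
      by (simp add: algebra_simps z)
    have "x + z * z = 2 *\<^sub>R z"
      using z(4) by (metis f_def scaleR_half_double scaleR_2 scaleR_scaleR mult.commute scaleR_one
          nonzero_eq_divide_eq zero_neq_numeral)
    then have "x = z + z - z * z"
      by (simp add: scaleR_2 algebra_simps)
    then show "(1 - z) * (1 - z) = 1 - x"
      by (simp add: algebra_simps)
  qed
qed

text \<open>
  A self-adjoint strict contraction \<open>k\<close> is the real part of the unitary
  \<open>k + \<i> \<surd>(1 - k\<^sup>2)\<close>, and unitaries are mapped to contractions.
\<close>

lemma star_hom_contractive:
  fixes \<pi> :: "'a::unital_cstar_algebra \<Rightarrow> 'b::unital_cstar_algebra"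
  assumes hom: "star_hom A B \<pi>" and A: "cstar_subalgebra A" "1 \<in> A" and "x \<in> A"
  shows "norm (\<pi> x) \<le> norm x"
proof -
  \<comment> \<open>\<open>\<pi>\<close> need not be unital, but \<open>\<pi> 1\<close> is a
    projection.\<close>
  have pi1: "norm (\<pi> 1) \<le> 1"
    using norm_projection[of "\<pi> 1"] star_homD(4,5)[OF hom, of 1] A by fastforce
  have contr: "norm (\<pi> k) \<le> 1" if k: "k \<in> A" "star k = k" "norm k < 1" for k
  proof -
    have "norm (k * k) < 1"
      using cstar_identity[of k] k by (simp add: power_less_one_iff)
    moreover have "k * k \<in> A" "star (k * k) = k * k" "k * k * k = k * (k * k)"
      using k cstar_subalgebraD(4)[OF A(1)] by (simp_all add: star_mult mult.assoc)
    ultimately obtain c where c: "c \<in> A" "star c = c" "c * k = k * c" "c * c = 1 - k * k"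
      using square_root_one_minus[OF A] by blast
    define u where "u = k + \<i> *\<^sub>C c"
    have u: "u \<in> A"
      unfolding u_def by (intro cstar_subalgebraD[OF A(1)] k c)
    have star_u: "star u = k + (- \<i>) *\<^sub>C c"
      by (simp add: u_def star_add star_scaleC k c)
    have neg: "(- a) *\<^sub>C z = - (a *\<^sub>C z)" for a and z :: 'a
      by (metis scaleC_minus_one scaleC_scaleC mult_minus1)
    have "star u * u = k * k + c * c"
      unfolding star_u
      by (simp add: u_def algebra_simps mult_scaleC_left mult_scaleC_right scaleC_scaleC c(3) neg
          scaleC_diff_right scaleC_add_right)
    then have "star u * u = 1"
      by (simp add: c)
    then have "star (\<pi> u) * \<pi> u = \<pi> 1"
      using star_homD(4,5)[OF hom] u cstar_subalgebraD(6)[OF A(1)] by metis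
    then have "(norm (\<pi> u))\<^sup>2 \<le> 1\<^sup>2"
      using cstar_identity[of "\<pi> u"] pi1 by simp
    then have nu: "norm (\<pi> u) \<le> 1"
      by (rule power2_le_imp_le) simp
    have "u + star u = 2 *\<^sub>C k"
      using scaleC_add_left[of 1 1 k] unfolding star_u by (simp add: u_def neg)
    then have "2 *\<^sub>C \<pi> k = \<pi> u + star (\<pi> u)"
      by (metis hom star_homD(2,3,5) u k(1) A(1) cstar_subalgebraD(6))
    then have "norm (2 *\<^sub>C \<pi> k) \<le> norm (\<pi> u) + norm (star (\<pi> u))"
      by (metis norm_triangle_ineq)
    then show ?thesis
      using nu by (simp add: norm_scaleC norm_star)
  qed
  \<comment> \<open>Since \<open>contr\<close> needs norm strictly below 1, \<open>k\<close> is
    divided by an arbitrary \<open>r > norm k\<close>.\<close>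
  have sa: "norm (\<pi> k) \<le> norm k" if k: "k \<in> A" "star k = k" for k
  proof (rule dense_ge)
    fix r assume r: "norm k < r"
    then have "0 < r"
      by (meson le_less_trans norm_ge_zero)
    have "inverse r * norm k < 1"
      using r \<open>0 < r\<close> by (simp add: field_simps)
    then have "norm (complex_of_real (inverse r) *\<^sub>C k) < 1"
      using \<open>0 < r\<close> unfolding norm_scaleC norm_of_real by simp
    moreover have "star (complex_of_real (inverse r) *\<^sub>C k) = complex_of_real (inverse r) *\<^sub>C k"
      by (simp add: star_scaleC k)
    ultimately have "norm (\<pi> (complex_of_real (inverse r) *\<^sub>C k)) \<le> 1"
      using k by (intro contr cstar_subalgebraD[OF A(1)])
    then have "inverse r * norm (\<pi> k) \<le> 1"
      using \<open>0 < r\<close> unfolding star_homD(3)[OF hom k(1)] norm_scaleC norm_of_real by simp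
    then show "norm (\<pi> k) \<le> r"
      using \<open>0 < r\<close> by (simp add: field_simps)
  qed
  have "(norm (\<pi> x))\<^sup>2 = norm (\<pi> (star x * x))"
    using hom \<open>x \<in> A\<close> A by (simp add: cstar_identity star_homD(4,5)[OF hom] cstar_subalgebraD)
  also have "\<dots> \<le> norm (star x * x)"
    using A \<open>x \<in> A\<close> by (intro sa cstar_subalgebraD) (simp_all add: star_mult star_star cstar_subalgebraD)
  finally show ?thesis
    unfolding cstar_identity by (rule power2_le_imp_le) simp
qed

text \<open>Contractive homomorphisms are continuous, so the set where the two agree is a
  C*-subalgebra; it contains \<open>S\<close>.\<close>

lemma star_hom_eq_on_generated:
  fixes \<pi> \<rho> :: "'a::unital_cstar_algebra \<Rightarrow> 'b::unital_cstar_algebra"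
  assumes hom: "star_hom (cstar_generated S) B \<pi>" "star_hom (cstar_generated S) B' \<rho>"
    and one: "1 \<in> cstar_generated S" and eq: "\<And>s. s \<in> S \<Longrightarrow> \<pi> s = \<rho> s" and "x \<in> cstar_generated S"
  shows "\<pi> x = \<rho> x"
proof -
  let ?A = "cstar_generated S"
  note A = cstar_subalgebra_generated[of S]
  have lip: "1-lipschitz_on ?A \<pi>" if "star_hom ?A C \<pi>" for C and \<pi> :: "'a \<Rightarrow> 'b"
    using star_hom_contractive[OF that A one] star_hom_diff[OF that A] cstar_subalgebra_diff[OF A]
    by (intro lipschitz_onI) (simp_all add: dist_norm, metis)
  let ?E = "{x \<in> ?A. \<pi> x - \<rho> x \<in> {0}}"
  have "closed ?E"
    by (intro continuous_closed_preimage[unfolded vimage_def Int_def mem_Collect_eq] continuous_intros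
        lipschitz_on_continuous_on[OF lip[OF hom(1)]] lipschitz_on_continuous_on[OF lip[OF hom(2)]]
        cstar_subalgebraD[OF A] closed_singleton)
  moreover have "\<pi> 0 = 0" "\<rho> 0 = 0"
    using star_homD(3)[OF hom(1), of 0 0] star_homD(3)[OF hom(2), of 0 0] cstar_subalgebraD(2)[OF A] by simp_all
  ultimately have "cstar_subalgebra ?E"
    unfolding cstar_subalgebra_def
    using cstar_subalgebraD(2-)[OF A] star_homD(2-)[OF hom(1)] star_homD(2-)[OF hom(2)] by simp
  then have "?A \<subseteq> ?E"
    using eq cstar_generated_superset[of S] by (intro cstar_generated_least) auto
  then show ?thesis
    using \<open>x \<in> ?A\<close> by auto
qed

section \<open>Contractive relations between C*-algebras\<close>

text \<open>These are the *-subalgebras of the direct product. Homomorphisms are constructed as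
  relations of this kind that turn out to be single-valued.\<close>

definition star_relation :: "('a::unital_cstar_algebra \<times> 'b::unital_cstar_algebra) set \<Rightarrow> bool" where
  "star_relation G \<longleftrightarrow> (0, 0) \<in> G \<and>
     (\<forall>x y x' y'. (x, y) \<in> G \<longrightarrow> (x', y') \<in> G \<longrightarrow> (x + x', y + y') \<in> G \<and> (x * x', y * y') \<in> G) \<and>
     (\<forall>c x y. (x, y) \<in> G \<longrightarrow> (c *\<^sub>C x, c *\<^sub>C y) \<in> G) \<and>
     (\<forall>x y. (x, y) \<in> G \<longrightarrow> (star x, star y) \<in> G)"

lemma star_relationD:
  assumes "star_relation G"
  shows "(0, 0) \<in> G"
    "(x, y) \<in> G \<Longrightarrow> (x', y') \<in> G \<Longrightarrow> (x + x', y + y') \<in> G"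
    "(x, y) \<in> G \<Longrightarrow> (x', y') \<in> G \<Longrightarrow> (x * x', y * y') \<in> G"
    "(x, y) \<in> G \<Longrightarrow> (c *\<^sub>C x, c *\<^sub>C y) \<in> G"
    "(x, y) \<in> G \<Longrightarrow> (star x, star y) \<in> G"
  using assms unfolding star_relation_def by blast+

lemma star_relation_diff:
  "star_relation G \<Longrightarrow> (x, y) \<in> G \<Longrightarrow> (x', y') \<in> G \<Longrightarrow> (x - x', y - y') \<in> G"
  using star_relationD(2)[of G x y "(-1) *\<^sub>C x'" "(-1) *\<^sub>C y'"] star_relationD(4)[of G x' y' "-1"] by simp

lemma star_relation_converse: "star_relation G \<Longrightarrow> star_relation (G\<inverse>)"
  unfolding star_relation_def by auto

lemma star_relation_Int_Times:
  "star_relation G \<Longrightarrow> cstar_subalgebra A \<Longrightarrow> cstar_subalgebra B \<Longrightarrow> star_relation (G \<inter> A \<times> B)"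
  unfolding star_relation_def cstar_subalgebra_def by simp

text \<open>The operations are continuous, and the closure of \<open>G \<times> G\<close> is
  \<open>closure G \<times> closure G\<close>.\<close>

lemma star_relation_closure:
  assumes G: "star_relation G"
  shows "star_relation (closure G)"
proof -
  have bin: "f z z' \<in> closure G"
    if z: "z \<in> closure G" "z' \<in> closure G"
      and f: "continuous_on UNIV (\<lambda>u. f (fst u) (snd u))" "\<And>z z'. z \<in> G \<Longrightarrow> z' \<in> G \<Longrightarrow> f z z' \<in> G"
    for f and z z' :: "'a \<times> 'b"
  proof -
    have "(\<lambda>u. f (fst u) (snd u)) ` closure (G \<times> G) \<subseteq> closure G"
      using f(2) closure_subset[of G]
      by (intro image_closure_subset continuous_on_subset[OF f(1)]) auto
    then show ?thesis
      using z by (force simp: closure_Times)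
  qed
  have un: "f z \<in> closure G"
    if "z \<in> closure G" "continuous_on UNIV f" "\<And>z. z \<in> G \<Longrightarrow> f z \<in> G"
    for f and z :: "'a \<times> 'b"
  proof -
    have "f ` closure G \<subseteq> closure G"
      using that(3) closure_subset[of G]
      by (intro image_closure_subset continuous_on_subset[OF that(2)]) auto
    then show ?thesis
      using that(1) by blast
  qed
  show ?thesis
    unfolding star_relation_def
  proof (intro conjI allI impI)
    show "(0, 0) \<in> closure G"
      using star_relationD(1)[OF G] closure_subset by blast
    fix x y x' y' assume z: "(x, y) \<in> closure G" "(x', y') \<in> closure G"
    have "(\<lambda>z z'. (fst z + fst z', snd z + snd z')) (x, y) (x', y') \<in> closure G"
      by (rule bin[OF z]) (auto intro!: continuous_intros star_relationD[OF G])
    then show "(x + x', y + y') \<in> closure G"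
      by simp
    have "(\<lambda>z z'. (fst z * fst z', snd z * snd z')) (x, y) (x', y') \<in> closure G"
      by (rule bin[OF z]) (auto intro!: continuous_intros star_relationD[OF G])
    then show "(x * x', y * y') \<in> closure G"
      by simp
  next
    fix c x y assume z: "(x, y) \<in> closure G"
    have "(\<lambda>z. (c *\<^sub>C fst z, c *\<^sub>C snd z)) (x, y) \<in> closure G"
      by (rule un[OF z]) (auto intro!: continuous_intros star_relationD[OF G])
    then show "(c *\<^sub>C x, c *\<^sub>C y) \<in> closure G"
      by simp
  next
    fix x y assume z: "(x, y) \<in> closure G"
    have "(\<lambda>z. (star (fst z), star (snd z))) (x, y) \<in> closure G"
      by (rule un[OF z]) (auto intro!: continuous_intros star_relationD[OF G])
    then show "(star x, star y) \<in> closure G"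
      by simp
  qed
qed

lemma norm_le_closure:
  assumes "\<And>x y. (x, y) \<in> G \<Longrightarrow> norm y \<le> norm x" and "(x, y) \<in> closure G"
  shows "norm (y :: 'b::real_normed_vector) \<le> norm (x :: 'a::real_normed_vector)"
proof -
  have "closed {z :: 'a \<times> 'b. norm (snd z) \<le> norm (fst z)}"
    by (intro closed_Collect_le continuous_intros)
  then have "closure G \<subseteq> {z. norm (snd z) \<le> norm (fst z)}"
    using assms(1) by (intro closure_minimal) auto
  then show ?thesis
    using assms(2) by auto
qed

text \<open>Contractivity applied to differences makes the partners of a convergent sequence in the
  domain Cauchy; the limit pair stays in the closed set \<open>G\<close>.\<close>

lemma cstar_subalgebra_Domain:
  fixes G :: "('a::unital_cstar_algebra \<times> 'b::unital_cstar_algebra) set"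
  assumes "closed G" and G: "star_relation G" and contr: "\<And>x y. (x, y) \<in> G \<Longrightarrow> norm y \<le> norm x"
  shows "cstar_subalgebra (Domain G)"
proof -
  have "closed (Domain G)"
    unfolding closed_sequential_limits
  proof (intro allI impI, elim conjE)
    fix X l assume X: "\<forall>n. X n \<in> Domain G" "X \<longlonglongrightarrow> l"
    then obtain Y where Y: "\<And>n. (X n, Y n) \<in> G"
      unfolding Domain_iff by metis
    have "norm (Y m - Y n) \<le> norm (X m - X n)" for m n
      by (intro contr star_relation_diff[OF G] Y)
    then have "Cauchy Y"
      using LIMSEQ_imp_Cauchy[OF X(2)] unfolding Cauchy_def dist_norm by (meson le_less_trans)
    then obtain m where "Y \<longlonglongrightarrow> m"
      using Cauchy_convergent convergent_def by blast
    then have "(\<lambda>n. (X n, Y n)) \<longlonglongrightarrow> (l, m)"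
      by (intro tendsto_Pair X)
    then have "(l, m) \<in> G"
      using closed_sequentially[OF \<open>closed G\<close>, of "\<lambda>n. (X n, Y n)"] Y by blast
    then show "l \<in> Domain G"
      by blast
  qed
  moreover have "x + y \<in> Domain G" "x * y \<in> Domain G" if "x \<in> Domain G" "y \<in> Domain G" for x y
    using that star_relationD(2,3)[OF G] by (meson DomainE DomainI)+
  moreover have "c *\<^sub>C x \<in> Domain G" "star x \<in> Domain G" if "x \<in> Domain G" for c x
    using that star_relationD(4,5)[OF G] by (meson DomainE DomainI)+
  ultimately show ?thesis
    unfolding cstar_subalgebra_def using star_relationD(1)[OF G] by blast
qed

text \<open>If \<open>(x, y)\<close> and \<open>(x, y')\<close> lie in \<open>G\<close>, then so
  does \<open>(0, y - y')\<close>, and contractivity forces \<open>y = y'\<close>. The domain is a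
  C*-subalgebra, so it contains all that \<open>S\<close> generates.\<close>

lemma star_hom_of_contractive_relation:
  fixes G :: "('a::unital_cstar_algebra \<times> 'b::unital_cstar_algebra) set"
  assumes "closed G" and G: "star_relation G" and contr: "\<And>x y. (x, y) \<in> G \<Longrightarrow> norm y \<le> norm x"
    and S: "S \<subseteq> Domain G" and ran: "Range G \<subseteq> B"
  obtains \<pi> where "star_hom (cstar_generated S) B \<pi>" "\<And>x y. (x, y) \<in> G \<Longrightarrow> \<pi> x = y"
proof -
  define \<pi> where "\<pi> x = (THE y. (x, y) \<in> G)" for x
  have unique: "y = y'" if "(x, y) \<in> G" "(x, y') \<in> G" for x y y'
    using contr[OF star_relation_diff[OF G that]] by simp
  then have pi: "\<pi> x = y" if "(x, y) \<in> G" for x y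
    unfolding \<pi>_def using that by (intro the_equality) auto
  then have pi': "(x, \<pi> x) \<in> G" if "x \<in> Domain G" for x
    using that by auto
  have "cstar_generated S \<subseteq> Domain G"
    by (intro cstar_generated_least cstar_subalgebra_Domain assms)
  then have D: "x \<in> cstar_generated S \<Longrightarrow> (x, \<pi> x) \<in> G" for x
    using pi' by auto
  have "star_hom (cstar_generated S) B \<pi>"
    unfolding star_hom_def
    using D ran by (auto intro!: pi star_relationD[OF G])
  then show thesis
    using that pi by blast
qed

section \<open>Polynomials in an isometry\<close>

lemma isometry_power:
  fixes w :: "'a::unital_cstar_algebra"
  assumes "star w * w = 1"
  shows "star w ^ n * w ^ n = 1"
proof (induction n)
  case (Suc n)
  have "star w ^ Suc n * w ^ Suc n = star w ^ n * (star w * w) * w ^ n"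
    by (simp only: power_Suc2[of "star w"] power_Suc[of w] mult.assoc)
  then show ?case
    by (simp add: assms Suc)
qed simp

text \<open>Subtraction is truncated, so at least one exponent on the right is 0 and both orders of
  \<open>j\<close> and \<open>k\<close> are covered.\<close>

lemma isometry_power_cancel:
  fixes w :: "'a::unital_cstar_algebra"
  assumes w: "star w * w = 1"
  shows "star w ^ j * w ^ k = w ^ (k - j) * star w ^ (j - k)"
proof (cases "j \<le> k")
  case True
  then have "star w ^ j * w ^ k = star w ^ j * w ^ j * w ^ (k - j)"
    by (simp add: mult.assoc flip: power_add)
  then show ?thesis
    using True by (simp add: isometry_power[OF w])
next
  case False
  then have "star w ^ j * w ^ k = star w ^ (j - k) * (star w ^ k * w ^ k)"
    by (simp flip: power_add mult.assoc)
  then show ?thesis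
    using False by (simp add: isometry_power[OF w])
qed

definition toeplitz_monomial :: "'a::unital_cstar_algebra \<Rightarrow> nat \<times> nat \<Rightarrow> 'a" where
  "toeplitz_monomial w d = w ^ fst d * star w ^ snd d"

lemma star_toeplitz_monomial:
  "star (toeplitz_monomial w (i, j)) = toeplitz_monomial w (j, i)"
  by (simp add: toeplitz_monomial_def star_mult star_power star_star)

text \<open>This is the multiplication of the bicyclic monoid; it is the same for every
  isometry.\<close>

lemma toeplitz_monomial_mult:
  assumes "star w * w = 1"
  shows "toeplitz_monomial w (i, j) * toeplitz_monomial w (k, l)
    = toeplitz_monomial w (i + (k - j), l + (j - k))"
proof -
  have "toeplitz_monomial w (i, j) * toeplitz_monomial w (k, l)
      = w ^ i * (star w ^ j * w ^ k) * star w ^ l"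
    by (simp add: toeplitz_monomial_def mult.assoc)
  also have "\<dots> = w ^ i * w ^ (k - j) * (star w ^ (j - k) * star w ^ l)"
    by (simp add: isometry_power_cancel[OF assms] mult.assoc)
  finally show ?thesis
    by (simp add: toeplitz_monomial_def add.commute flip: power_add)
qed

lemma norm_toeplitz_monomial_le_one:
  assumes "star w * w = 1"
  shows "norm (toeplitz_monomial w d) \<le> 1"
proof -
  have n: "norm (w ^ k) \<le> 1" for k
    by (rule norm_isometry_le_one) (simp add: star_power isometry_power[OF assms])
  have "norm (toeplitz_monomial w d) \<le> norm (w ^ fst d) * norm (star (w ^ snd d))"
    unfolding toeplitz_monomial_def star_power by (rule norm_mult_ineq)
  also have "\<dots> \<le> 1 * 1"
    unfolding norm_star by (intro mult_mono n) simp_all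
  finally show ?thesis
    by simp
qed

definition toeplitz_poly :: "nat \<Rightarrow> (nat \<times> nat \<Rightarrow> complex) \<Rightarrow> 'a::unital_cstar_algebra \<Rightarrow> 'a" where
  "toeplitz_poly N c w = (\<Sum>d\<in>{..<N} \<times> {..<N}. c d *\<^sub>C toeplitz_monomial w d)"

lemma norm_toeplitz_poly_le:
  assumes w: "star w * w = 1" and c: "\<And>d. d \<in> {..<N} \<times> {..<N} \<Longrightarrow> cmod (c d) \<le> C"
  shows "norm (toeplitz_poly N c w) \<le> (real N)\<^sup>2 * C"
proof -
  have "norm (toeplitz_poly N c w) \<le> (\<Sum>d\<in>{..<N} \<times> {..<N}. C * 1)"
    unfolding toeplitz_poly_def
  proof (rule sum_norm_le)
    fix d assume d: "d \<in> {..<N} \<times> {..<N}"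
    have "0 \<le> C"
      using c[OF d] norm_ge_zero order_trans by blast
    then show "norm (c d *\<^sub>C toeplitz_monomial w d) \<le> C * 1"
      unfolding norm_scaleC by (intro mult_mono c d norm_toeplitz_monomial_le_one w) simp_all
  qed
  then show ?thesis
    by (simp add: power2_eq_square)
qed

section \<open>Matrix entries and coefficients of a polynomial\<close>

text \<open>\<open>e\<close> is the projection onto the complement of the range of \<open>w\<close>;
  the power rules come from \<open>e * w = 0\<close> and \<open>star w * e = 0\<close>.\<close>

lemma isometry_defect:
  fixes w :: "'a::unital_cstar_algebra"
  assumes w: "star w * w = 1"
  defines "e \<equiv> 1 - w * star w"
  shows "star e = e" "e * e = e" "e * w ^ n = (if n = 0 then e else 0)"
    "star w ^ n * e = (if n = 0 then e else 0)"
proof -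
  have ew: "e * w = 0" and we: "star w * e = 0"
    using w by (simp_all add: e_def algebra_simps) (simp add: mult.assoc[symmetric])
  show "star e = e"
    by (simp add: e_def star_diff star_mult star_star)
  have "e * (w * star w) = 0"
    using ew by (simp add: mult.assoc[symmetric])
  moreover have "e * e = e - e * (w * star w)"
    by (subst (2) e_def) (simp add: algebra_simps)
  ultimately show "e * e = e"
    by simp
  show "e * w ^ n = (if n = 0 then e else 0)"
    using ew by (cases n) (simp_all add: mult.assoc[symmetric])
  show "star w ^ n * e = (if n = 0 then e else 0)"
    using we by (cases n) (simp_all add: mult.assoc power_Suc2 del: power_Suc)
qed

text \<open>After cancellation \<open>e\<close> annihilates every surviving power of
  \<open>w\<close> on its right and of \<open>star w\<close> on its left. Only the case in which all
  truncated exponents vanish remains.\<close>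

lemma corner_toeplitz_monomial:
  fixes w :: "'a::unital_cstar_algebra"
  assumes w: "star w * w = 1"
  defines "e \<equiv> 1 - w * star w"
  shows "e * star w ^ k * toeplitz_monomial w (i, j) * w ^ m * e
    = (if i \<le> k \<and> j \<le> m \<and> k - i = m - j then e else 0)"
proof -
  note e = isometry_defect[OF w, folded e_def]
  have "e * star w ^ k * toeplitz_monomial w (i, j) * w ^ m * e
      = e * (star w ^ k * w ^ i) * (star w ^ j * w ^ m) * e"
    by (simp add: toeplitz_monomial_def mult.assoc)
  also have "\<dots> = (e * w ^ (i - k)) * (star w ^ (k - i) * w ^ (m - j)) * (star w ^ (j - m) * e)"
    by (simp add: isometry_power_cancel[OF w, of k i] isometry_power_cancel[OF w, of j m] mult.assoc)
  also have "\<dots> = (e * w ^ (i - k)) * w ^ ((m - j) - (k - i)) * (star w ^ ((k - i) - (m - j)) * (star w ^ (j - m) * e))"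
    by (simp add: isometry_power_cancel[OF w, of "k - i"] mult.assoc)
  also have "\<dots> = (if i \<le> k \<and> j \<le> m \<and> k - i = m - j then e else 0)"
    by (auto simp: e)
  finally show ?thesis .
qed

text \<open>
  The corners \<open>e w\<^sup>*\<^sup>k x w\<^sup>m e\<close> are the matrix entries of \<open>x\<close>, which are sums of coefficients
  along diagonals; the difference of two neighbours on a diagonal isolates one coefficient.
\<close>

lemma coeff_le_norm_toeplitz_poly:
  fixes w :: "'a::unital_cstar_algebra"
  assumes w: "star w * w = 1" and ne: "w * star w \<noteq> 1" and d: "d \<in> {..<N} \<times> {..<N}"
  shows "cmod (c d) \<le> 2 * norm (toeplitz_poly N c w)"
proof -
  obtain k m where km: "d = (k, m)"
    by (cases d)
  define e where "e = 1 - w * star w"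
  note e = isometry_defect[OF w, folded e_def]
  define \<phi> where "\<phi> k m x = e * star w ^ k * x * w ^ m * e" for k m x
  \<comment> \<open>On the edge of the matrix there is no preceding entry on the diagonal, so 0 is
    subtracted; truncated indices would pick a wrong entry.\<close>
  define \<psi> where "\<psi> x = \<phi> k m x - (if k = 0 \<or> m = 0 then 0 else \<phi> (k - 1) (m - 1) x)" for x
  have \<phi>_sum: "\<phi> k m (\<Sum>i\<in>I. c i *\<^sub>C f i) = (\<Sum>i\<in>I. c i *\<^sub>C \<phi> k m (f i))"
    for k m and I :: "(nat \<times> nat) set" and c f
    by (simp add: \<phi>_def sum_distrib_left sum_distrib_right mult_scaleC_left mult_scaleC_right)
  have \<psi>_sum: "\<psi> (\<Sum>i\<in>I. c i *\<^sub>C f i) = (\<Sum>i\<in>I. c i *\<^sub>C \<psi> (f i))" for I :: "(nat \<times> nat) set" and c f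
    by (simp add: \<psi>_def \<phi>_sum scaleC_diff_right sum_subtractf)
  have \<psi>_mono: "\<psi> (toeplitz_monomial w d') = (if d' = d then e else 0)" for d'
  proof -
    obtain i j where ij: "d' = (i, j)"
      by (cases d')
    have \<phi>_mono: "\<phi> k m (toeplitz_monomial w d') = (if i \<le> k \<and> j \<le> m \<and> k - i = m - j then e else 0)" for k m
      unfolding ij \<phi>_def e_def by (rule corner_toeplitz_monomial[OF w])
    consider "i = k" "j = m" | "\<not> (i = k \<and> j = m)" "k = 0 \<or> m = 0" | "\<not> (i = k \<and> j = m)" "0 < k" "0 < m"
      by blast
    then show ?thesis
    proof cases
      case 1
      then show ?thesis
        unfolding \<psi>_def \<phi>_mono by (cases k; cases m) (simp_all add: ij km)
    next
      case 2
      then have "\<not> (i \<le> k \<and> j \<le> m \<and> k - i = m - j)"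
        by arith
      then show ?thesis
        unfolding \<psi>_def \<phi>_mono using 2 by (auto simp: ij km)
    next
      case 3
      \<comment> \<open>Away from the edge, any monomial other than \<open>d\<close> contributes
        equally to both neighbouring entries and cancels.\<close>
      then have "(i \<le> k \<and> j \<le> m \<and> k - i = m - j) \<longleftrightarrow> (i \<le> k - 1 \<and> j \<le> m - 1 \<and> k - 1 - i = m - 1 - j)"
        by (cases k; cases m) (auto simp: le_Suc_eq Suc_diff_le)
      then show ?thesis
        unfolding \<psi>_def \<phi>_mono using 3 by (auto simp: ij km)
    qed
  qed
  have "\<psi> (toeplitz_poly N c w) = (\<Sum>d'\<in>{..<N} \<times> {..<N}. if d' = d then c d *\<^sub>C e else 0)"
    unfolding toeplitz_poly_def \<psi>_sum \<psi>_mono by (rule sum.cong) auto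
  then have "\<psi> (toeplitz_poly N c w) = c d *\<^sub>C e"
    using d by (simp add: sum.delta)
  \<comment> \<open>Non-unitarity of \<open>w\<close> enters here, by excluding
    \<open>e = 0\<close>.\<close>
  moreover have "norm e = 1"
    using norm_projection[OF e(1,2)] ne by (auto simp: e_def)
  ultimately have c_eq: "cmod (c d) = norm (\<psi> (toeplitz_poly N c w))"
    by (simp add: norm_scaleC)
  have n: "norm (w ^ k) \<le> 1" "norm (star w ^ k) \<le> 1" for k
    using norm_toeplitz_monomial_le_one[OF w, of "(k, 0)"] norm_toeplitz_monomial_le_one[OF w, of "(0, k)"]
    by (simp_all add: toeplitz_monomial_def)
  have mult_le: "norm (a * b) \<le> r * s" if "norm a \<le> r" "norm b \<le> s" for a b :: 'a and r s
  proof -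
    have "norm a * norm b \<le> r * s"
      using that order_trans[OF norm_ge_zero that(1)] by (intro mult_mono) simp_all
    then show ?thesis
      using norm_mult_ineq[of a b] by (rule order_trans[rotated])
  qed
  have \<phi>_le: "norm (\<phi> k m x) \<le> norm x" for k m x
  proof -
    have "norm (\<phi> k m x) \<le> 1 * 1 * norm x * 1 * 1"
      unfolding \<phi>_def by (intro mult_le n order_refl) (simp_all add: \<open>norm e = 1\<close>)
    then show ?thesis
      by simp
  qed
  have "norm (\<psi> x) \<le> norm x + norm x" for x
  proof (cases "k = 0 \<or> m = 0")
    case True
    then have psi: "\<psi> x = \<phi> k m x"
      unfolding \<psi>_def by simp
    show ?thesis
      unfolding psi using \<phi>_le[of k m x] norm_ge_zero[of x] by linarith
  next
    case False
    then have psi: "\<psi> x = \<phi> k m x - \<phi> (k - 1) (m - 1) x"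
      unfolding \<psi>_def by simp
    show ?thesis
      unfolding psi using \<phi>_le[of k m x] \<phi>_le[of "k - 1" "m - 1" x]
        norm_triangle_ineq4[of "\<phi> k m x" "\<phi> (k - 1) (m - 1) x"] by linarith
  qed
  then show ?thesis
    unfolding c_eq by (metis mult_2)
qed

section \<open>Pairs of polynomials with common coefficients\<close>

text \<open>The exponent bound \<open>N\<close> is kept as an index because the first norm estimate
  depends on it.\<close>

definition toeplitz_pairs ::
  "'a::unital_cstar_algebra \<Rightarrow> 'b::unital_cstar_algebra \<Rightarrow> nat \<Rightarrow> ('a \<times> 'b) set" where
  "toeplitz_pairs w v N = range (\<lambda>c. (toeplitz_poly N c w, toeplitz_poly N c v))"

lemma toeplitz_pairs_add:
  assumes "(x, y) \<in> toeplitz_pairs w v N" "(x', y') \<in> toeplitz_pairs w v N"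
  shows "(x + x', y + y') \<in> toeplitz_pairs w v N"
proof -
  obtain c c' where "x = toeplitz_poly N c w" "y = toeplitz_poly N c v"
    "x' = toeplitz_poly N c' w" "y' = toeplitz_poly N c' v"
    using assms unfolding toeplitz_pairs_def by blast
  then show ?thesis
    unfolding toeplitz_pairs_def
    by (intro range_eqI[of _ _ "\<lambda>d. c d + c' d"]) (simp add: toeplitz_poly_def scaleC_add_left sum.distrib)
qed

lemma toeplitz_pairs_scaleC:
  assumes "(x, y) \<in> toeplitz_pairs w v N"
  shows "(a *\<^sub>C x, a *\<^sub>C y) \<in> toeplitz_pairs w v N"
proof -
  obtain c where "x = toeplitz_poly N c w" "y = toeplitz_poly N c v"
    using assms unfolding toeplitz_pairs_def by blast
  then show ?thesis
    unfolding toeplitz_pairs_def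
    by (intro range_eqI[of _ _ "\<lambda>d. a * c d"]) (simp add: toeplitz_poly_def scaleC_sum_right scaleC_scaleC)
qed

lemma toeplitz_poly_single:
  assumes "i < N" "j < N"
  shows "toeplitz_poly N (\<lambda>d. if d = (i, j) then 1 else 0) w = toeplitz_monomial w (i, j)"
proof -
  have "toeplitz_poly N (\<lambda>d. if d = (i, j) then 1 else 0) w
      = (\<Sum>d\<in>{..<N} \<times> {..<N}. if d = (i, j) then toeplitz_monomial w d else 0)"
    unfolding toeplitz_poly_def by (rule sum.cong) auto
  then show ?thesis
    using assms by (simp add: sum.delta)
qed

lemma toeplitz_pairs_monomial:
  assumes "i < N" "j < N"
  shows "(toeplitz_monomial w (i, j), toeplitz_monomial v (i, j)) \<in> toeplitz_pairs w v N"
  unfolding toeplitz_pairs_def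
  by (intro range_eqI[of _ _ "\<lambda>d. if d = (i, j) then 1 else 0"]) (simp add: toeplitz_poly_single assms)

lemma toeplitz_pairs_zero: "(0, 0) \<in> toeplitz_pairs w v N"
  unfolding toeplitz_pairs_def
  by (intro range_eqI[of _ _ "\<lambda>d. 0"]) (simp add: toeplitz_poly_def)

lemma toeplitz_pairs_sum:
  assumes "\<And>i. i \<in> I \<Longrightarrow> (f i, g i) \<in> toeplitz_pairs w v N"
  shows "(\<Sum>i\<in>I. f i, \<Sum>i\<in>I. g i) \<in> toeplitz_pairs w v N"
  using assms
  by (induction I rule: infinite_finite_induct)
    (simp_all add: toeplitz_pairs_zero toeplitz_pairs_add)

lemma toeplitz_pairs_mono:
  assumes "(x, y) \<in> toeplitz_pairs w v M" "M \<le> N"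
  shows "(x, y) \<in> toeplitz_pairs w v N"
proof -
  obtain c where c: "x = toeplitz_poly M c w" "y = toeplitz_poly M c v"
    using assms unfolding toeplitz_pairs_def by blast
  show ?thesis
    unfolding c toeplitz_poly_def using assms(2)
    by (intro toeplitz_pairs_sum toeplitz_pairs_scaleC) (auto intro!: toeplitz_pairs_monomial)
qed

lemma toeplitz_pairs_star:
  assumes "(x, y) \<in> toeplitz_pairs w v N"
  shows "(star x, star y) \<in> toeplitz_pairs w v N"
proof -
  obtain c where c: "x = toeplitz_poly N c w" "y = toeplitz_poly N c v"
    using assms unfolding toeplitz_pairs_def by blast
  show ?thesis
    unfolding c toeplitz_poly_def star_sum star_scaleC
    by (intro toeplitz_pairs_sum toeplitz_pairs_scaleC)
      (auto simp: star_toeplitz_monomial intro!: toeplitz_pairs_monomial)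
qed

text \<open>Both products expand with the same coefficients, and exponents such as
  \<open>i + (k - j)\<close> stay below \<open>M + N\<close>.\<close>

lemma toeplitz_pairs_mult:
  assumes w: "star w * w = 1" and v: "star v * v = 1"
    and "(x, y) \<in> toeplitz_pairs w v M" "(x', y') \<in> toeplitz_pairs w v N"
  shows "(x * x', y * y') \<in> toeplitz_pairs w v (M + N)"
proof -
  obtain c c' where c: "x = toeplitz_poly M c w" "y = toeplitz_poly M c v"
    "x' = toeplitz_poly N c' w" "y' = toeplitz_poly N c' v"
    using assms unfolding toeplitz_pairs_def by blast
  show ?thesis
    unfolding c toeplitz_poly_def sum_product mult_scaleC_left mult_scaleC_right
    by (intro toeplitz_pairs_sum toeplitz_pairs_scaleC)
      (auto simp: toeplitz_monomial_mult w v intro!: toeplitz_pairs_monomial)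
qed

text \<open>The exponent is positive because the bound \<open>N * 0\<close> would leave only the
  zero polynomial.\<close>

lemma toeplitz_pairs_power:
  assumes w: "star w * w = 1" and v: "star v * v = 1" and "(x, y) \<in> toeplitz_pairs w v N"
  shows "(x ^ Suc n, y ^ Suc n) \<in> toeplitz_pairs w v (N * Suc n)"
proof (induction n)
  case (Suc n)
  then show ?case
    using toeplitz_pairs_mult[OF w v assms(3) Suc] by simp
qed (use assms in simp)

lemma toeplitz_pairs_norm_le_poly:
  fixes w :: "'a::unital_cstar_algebra" and v :: "'b::unital_cstar_algebra"
  assumes w: "star w * w = 1" "w * star w \<noteq> 1" and v: "star v * v = 1"
    and xy: "(x, y) \<in> toeplitz_pairs w v N"
  shows "norm y \<le> 2 * (real N)\<^sup>2 * norm x"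
proof -
  obtain c where c: "x = toeplitz_poly N c w" "y = toeplitz_poly N c v"
    using xy unfolding toeplitz_pairs_def by blast
  show ?thesis
    unfolding c
    using norm_toeplitz_poly_le[OF v, of N c "2 * norm (toeplitz_poly N c w)"]
      coeff_le_norm_toeplitz_poly[OF w] by (simp add: mult_ac)
qed

text \<open>If \<open>b < a\<close>, the geometric decay of \<open>(b / a) ^ n\<close> along
  \<open>n = 2 ^ k\<close> beats the quadratic factor.\<close>

lemma power_le_quadratic_imp_le:
  fixes a b C :: real
  assumes "0 \<le> a" "0 \<le> b" and le: "\<And>k. a ^ 2 ^ k \<le> C * (2 ^ k)\<^sup>2 * b ^ 2 ^ k"
  shows "a \<le> b"
proof (rule ccontr)
  assume "\<not> a \<le> b"
  then have "b < a" by simp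
  \<comment> \<open>With this root, \<open>n\<^sup>2 * (b / a) ^ n\<close> is the square of
    \<open>n * q ^ n\<close>, which tends to 0.\<close>
  define q where "q = sqrt (b / a)"
  have q: "0 \<le> q" "q < 1" and a: "0 < a"
    using \<open>b < a\<close> assms by (simp_all add: q_def)
  have "(\<lambda>n. real n * q ^ n) \<longlonglongrightarrow> 0"
    using q by (intro powser_times_n_limit_0) simp
  then have "(\<lambda>n. C * (real n * q ^ n)\<^sup>2) \<longlonglongrightarrow> C * 0\<^sup>2"
    by (intro tendsto_intros)
  then have "eventually (\<lambda>n. C * (real n * q ^ n)\<^sup>2 < 1) sequentially"
    by (rule order_tendstoD) simp
  then obtain N where N: "\<And>n. n \<ge> N \<Longrightarrow> C * (real n * q ^ n)\<^sup>2 < 1"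
    unfolding eventually_sequentially by blast
  have "N \<le> 2 ^ N"
    by (simp add: less_imp_le)
  from N[OF this] have "C * (2 ^ N)\<^sup>2 * (q\<^sup>2) ^ 2 ^ N < 1"
    by (simp add: power_mult_distrib mult.commute flip: power_mult)
  moreover have "q\<^sup>2 = b / a"
    using a assms by (simp add: q_def)
  ultimately have "C * (2 ^ N)\<^sup>2 * b ^ 2 ^ N < a ^ 2 ^ N"
    using a by (simp add: power_divide)
  then show False
    using le[of N] by simp
qed

text \<open>
  The degree of \<open>(x\<^sup>*x)\<^sup>n\<close> grows linearly in \<open>n\<close>, so the C*-identity improves a bound that is
  polynomial in the degree to the bound with constant \<open>1\<close>.
\<close>

lemma toeplitz_pairs_contractive:
  fixes w :: "'a::unital_cstar_algebra" and v :: "'b::unital_cstar_algebra"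
  assumes w: "star w * w = 1" "w * star w \<noteq> 1" and v: "star v * v = 1"
    and xy: "(x, y) \<in> toeplitz_pairs w v N"
  shows "norm y \<le> norm x"
proof -
  have "norm (star y * y) \<le> norm (star x * x)"
  proof (rule power_le_quadratic_imp_le)
    fix k
    have "(star x * x, star y * y) \<in> toeplitz_pairs w v (N + N)"
      by (intro toeplitz_pairs_mult toeplitz_pairs_star w v xy)
    \<comment> \<open>\<open>2 ^ k\<close> is treated as the successor of \<open>2 ^ k - 1\<close>,
      to match the form of \<open>toeplitz_pairs_power\<close>.\<close>
    then have "((star x * x) ^ 2 ^ k, (star y * y) ^ 2 ^ k) \<in> toeplitz_pairs w v ((N + N) * 2 ^ k)"
      using toeplitz_pairs_power[OF w(1) v, of _ _ _ "2 ^ k - 1"] by simp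
    from toeplitz_pairs_norm_le_poly[OF w v this]
    have "norm ((star y * y) ^ 2 ^ k) \<le> 2 * (real (N + N) * 2 ^ k)\<^sup>2 * norm ((star x * x) ^ 2 ^ k)"
      by simp
    then show "norm (star y * y) ^ 2 ^ k \<le> 2 * (real (N + N))\<^sup>2 * (2 ^ k)\<^sup>2 * norm (star x * x) ^ 2 ^ k"
      by (simp add: norm_self_adjoint_power star_mult star_star power_mult_distrib mult.assoc)
  qed simp_all
  then show ?thesis
    unfolding cstar_identity by (rule power2_le_imp_le) simp
qed

lemma star_relation_toeplitz_pairs:
  assumes w: "star w * w = 1" and v: "star v * v = 1"
  shows "star_relation (\<Union>N. toeplitz_pairs w v N)"
  unfolding star_relation_def
proof (intro conjI allI impI)
  show "(0, 0) \<in> (\<Union>N. toeplitz_pairs w v N)"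
    using toeplitz_pairs_zero by blast
next
  fix x y x' y'
  assume "(x, y) \<in> (\<Union>N. toeplitz_pairs w v N)" "(x', y') \<in> (\<Union>N. toeplitz_pairs w v N)"
  then obtain M N where "(x, y) \<in> toeplitz_pairs w v M" "(x', y') \<in> toeplitz_pairs w v N"
    by blast
  then have p: "(x, y) \<in> toeplitz_pairs w v (max M N)" "(x', y') \<in> toeplitz_pairs w v (max M N)"
    by (auto elim: toeplitz_pairs_mono)
  show "(x + x', y + y') \<in> (\<Union>N. toeplitz_pairs w v N)" "(x * x', y * y') \<in> (\<Union>N. toeplitz_pairs w v N)"
    using toeplitz_pairs_add[OF p] toeplitz_pairs_mult[OF w v p] by blast+
next
  fix c x y
  assume "(x, y) \<in> (\<Union>N. toeplitz_pairs w v N)"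
  then obtain N where p: "(x, y) \<in> toeplitz_pairs w v N"
    by blast
  show "(c *\<^sub>C x, c *\<^sub>C y) \<in> (\<Union>N. toeplitz_pairs w v N)" "(star x, star y) \<in> (\<Union>N. toeplitz_pairs w v N)"
    using toeplitz_pairs_scaleC[OF p] toeplitz_pairs_star[OF p] by blast+
qed

section \<open>Words and the left regular representation\<close>

text \<open>The displacement of a basis vector under the word; the shifts in \<open>K_set\<close>
  are its negatives for the suffixes.\<close>

definition word_shift :: "word \<Rightarrow> int" where
  "word_shift \<alpha> = (\<Sum>(p, q)\<leftarrow>\<alpha>. - int_of_sig p + int_of_sig q)"

lemma word_shift_simps [simp]:
  "word_shift [] = 0"
  "word_shift ((p, q) # \<alpha>) = word_shift \<alpha> - int_of_sig p + int_of_sig q"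
  by (simp_all add: word_shift_def)

lemma neutral_iff_word_shift: "neutral \<alpha> \<longleftrightarrow> word_shift \<alpha> = 0"
  by (simp add: neutral_def word_shift_def)

lemma K_set_Nil [simp]: "x \<in> K_set [] \<longleftrightarrow> x \<in> Sig"
  by (simp add: K_set_def)

text \<open>Reading pairs from the right, each complete pair adds one condition: the point reached
  must lie in \<open>Sig\<close>.\<close>

lemma K_set_Cons [simp]:
  "x \<in> K_set ((p, q) # \<alpha>) \<longleftrightarrow> x \<in> K_set \<alpha> \<and> x + word_shift ((p, q) # \<alpha>) \<in> Sig"
proof -
  have "(\<Sum>(p, q)\<leftarrow>\<beta>. - int_of_sig q + int_of_sig p) = - word_shift \<beta>" for \<beta>
    by (induction \<beta>) auto
  moreover have "x \<in> (+) (- s) ` Sig \<longleftrightarrow> x + s \<in> Sig" for s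
    by (auto intro!: image_eqI[of _ _ "x + s"])
  ultimately have "x \<in> K_set \<beta> \<longleftrightarrow> x \<in> Sig \<and> (\<forall>j<length \<beta>. x + word_shift (drop j \<beta>) \<in> Sig)" for \<beta>
    by (auto simp: K_set_def)
  then show ?thesis
    by (simp add: All_less_Suc2 del: word_shift_simps) blast
qed

lemma word_prod_simps [simp]:
  "word_prod V [] = 1"
  "word_prod V ((p, q) # \<alpha>) = star (V p) * V q * word_prod V \<alpha>"
  by (simp_all add: word_prod_def)

lemma int_of_sig_in_Sig [simp]: "int_of_sig p \<in> Sig"
  using int_of_sig by simp

lemma int_of_sig_numeral [simp]:
  "int_of_sig (sig_of_int 2) = 2" "int_of_sig (sig_of_int 3) = 3"
  by (simp_all add: sig_of_int_inverse Sig_def)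

lemmas int_of_sig_simps [simp] = zero_sig.rep_eq plus_sig.rep_eq

lemma op_apply_zero_right [simp]: "op_apply T 0 = 0"
  using op_apply_scaleC[of T 0 0] by (simp add: zero_ell2_def scaleC_ell2_def ell2_of_inverse)

section \<open>The left regular representation on basis vectors\<close>

text \<open>The coordinates of \<open>star S\<close> at \<open>y\<close> are inner products of
  \<open>y\<close> with the vectors \<open>op_apply S (ket i)\<close>. So these vectors determine
  the adjoint, and with it \<open>S\<close>.\<close>

lemma op_eq_on_kets:
  assumes "\<And>i. op_apply S (ket i) = op_apply T (ket i)"
  shows "S = T"
proof -
  have "star S = star T"
  proof (intro op_eqI ell2_eqI)
    fix y i
    have "cnj (coord (op_apply (star S) y) i) = cnj (coord (op_apply (star T) y) i)"
      by (simp add: assms flip: cinner_ket_left cinner_star)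
    then show "coord (op_apply (star S) y) i = coord (op_apply (star T) y) i"
      by simp
  qed
  then show ?thesis
    by (metis star_star)
qed

lemma coord_star_left_shift: "coord (op_apply (star (left_shift p)) y) i = coord y (p + i)"
proof -
  have "cnj (coord (op_apply (star (left_shift p)) y) i) = cnj (coord y (p + i))"
    by (simp add: left_shift_ket flip: cinner_ket_left cinner_star)
  then show ?thesis
    by simp
qed

lemma star_left_shift_ket:
  "op_apply (star (left_shift p)) (ket r)
    = (if int_of_sig r - int_of_sig p \<in> Sig then ket (sig_of_int (int_of_sig r - int_of_sig p)) else 0)"
proof (rule ell2_eqI)
  fix i
  have "p + i = r \<longleftrightarrow> int_of_sig i = int_of_sig r - int_of_sig p"
    by (auto simp flip: int_of_sig_inject)
  moreover have "i = sig_of_int n \<longleftrightarrow> int_of_sig i = n" if "n \<in> Sig" for n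
    using that by (auto simp: sig_of_int_inverse int_of_sig_inverse)
  moreover have "int_of_sig i \<noteq> n" if "n \<notin> Sig" for n
    using that by (metis int_of_sig_in_Sig)
  ultimately show "coord (op_apply (star (left_shift p)) (ket r)) i
    = coord (if int_of_sig r - int_of_sig p \<in> Sig then ket (sig_of_int (int_of_sig r - int_of_sig p)) else 0) i"
    by (simp add: coord_star_left_shift coord_ket)
qed

text \<open>Both claims go through one induction: the second, for the shorter word, is what allows
  \<open>sig_of_int\<close> to be undone in the first.\<close>

lemma word_prod_left_shift_ket:
  "op_apply (word_prod left_shift \<alpha>) (ket r)
    = (if int_of_sig r \<in> K_set \<alpha> then ket (sig_of_int (int_of_sig r + word_shift \<alpha>)) else 0)"
  and K_set_shift: "int_of_sig r \<in> K_set \<alpha> \<Longrightarrow> int_of_sig r + word_shift \<alpha> \<in> Sig"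
proof (induction \<alpha>)
  case Nil
  {
    case 1
    then show ?case
      by (simp add: int_of_sig_inverse)
  next
    case 2
    then show ?case
      by simp
  }
next
  case (Cons a \<alpha>)
  obtain p q where a: "a = (p, q)"
    by (cases a)
  {
    case 1
    show ?case
    proof (cases "int_of_sig r \<in> K_set \<alpha>")
      case True
      then have "int_of_sig (sig_of_int (int_of_sig r + word_shift \<alpha>)) = int_of_sig r + word_shift \<alpha>"
        using Cons.IH(2) by (simp add: sig_of_int_inverse)
      then show ?thesis
        using True by (simp add: a Cons.IH(1) left_shift_ket star_left_shift_ket algebra_simps)
    qed (simp add: a Cons.IH(1))
  next
    case 2
    then show ?case
      by (simp add: a)
  }
qed

lemma word_prod_left_shift_ket_neutral:
  assumes "neutral \<alpha>"
  shows "op_apply (word_prod left_shift \<alpha>) (ket r) = (if int_of_sig r \<in> K_set \<alpha> then ket r else 0)"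
  using assms by (simp add: word_prod_left_shift_ket neutral_iff_word_shift int_of_sig_inverse)

lemma left_shift_zero: "left_shift 0 = 1"
  by (rule op_eq_on_kets) (simp add: left_shift_ket)

text \<open>A neutral word acts as the diagonal projection onto the basis vectors indexed by
  \<open>K_set\<close>, so it depends on that set only.\<close>

lemma toeplitz_relations_left_shift: "toeplitz_relations (left_shift :: sig \<Rightarrow> sig ell2_op)"
  unfolding toeplitz_relations_def
proof (intro conjI allI impI; (elim conjE)?)
  show "left_shift 0 = (1 :: sig ell2_op)"
    by (rule left_shift_zero)
next
  fix \<alpha> assume \<alpha>: "neutral \<alpha>" "K_set \<alpha> = {}"
  have "op_apply 0 x = 0" for x :: "sig ell2"
    using op_apply_simps(3)[of 0 0 x] by simp
  then show "word_prod left_shift \<alpha> = (0 :: sig ell2_op)"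
    by (intro op_eq_on_kets) (simp add: word_prod_left_shift_ket_neutral \<alpha>)
next
  fix \<alpha> \<beta> assume "neutral \<alpha>" "neutral \<beta>" "K_set \<alpha> = K_set \<beta>"
  then show "word_prod left_shift \<alpha> = (word_prod left_shift \<beta> :: sig ell2_op)"
    by (intro op_eq_on_kets) (simp add: word_prod_left_shift_ket_neutral)
qed

section \<open>The isometry generating the algebra\<close>

text \<open>\<open>star (a - b) * (a - b)\<close> expands to 0. This transfers (T3), which concerns
  neutral words, to elements with non-zero shift.\<close>

lemma eq_of_star_mult_eq:
  fixes a b :: "'a::unital_cstar_algebra"
  assumes "star a * a = c" "star a * b = c" "star b * a = c" "star b * b = c"
  shows "a = b"
proof -
  have "star (a - b) * (a - b) = 0"
    using assms by (simp add: star_diff algebra_simps)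
  then show ?thesis
    using star_mult_eq_zeroD by fastforce
qed

locale sigma_toeplitz =
  fixes V :: "sig \<Rightarrow> 'a::unital_cstar_algebra"
  assumes relations: "toeplitz_relations V"
    and extra: "star (V (sig_of_int 3)) * V (sig_of_int 2) * star (V (sig_of_int 2)) * V (sig_of_int 3)
         = V (sig_of_int 2) * star (V (sig_of_int 2)) + V (sig_of_int 3) * star (V (sig_of_int 3))
           - V (sig_of_int 2) * star (V (sig_of_int 2)) * V (sig_of_int 3) * star (V (sig_of_int 3))"
begin

lemma V_zero: "V 0 = 1"
  using relations unfolding toeplitz_relations_def by blast

lemma word_prod_eqI:
  assumes "word_shift \<alpha> = 0" "word_shift \<beta> = 0" "\<And>x. x \<in> K_set \<alpha> \<longleftrightarrow> x \<in> K_set \<beta>"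
  shows "word_prod V \<alpha> = word_prod V \<beta>"
proof -
  have "K_set \<alpha> = K_set \<beta>"
    using assms(3) by blast
  then show ?thesis
    using assms(1,2) relations unfolding toeplitz_relations_def neutral_iff_word_shift by blast
qed

lemma V_isometry: "star (V p) * V p = 1"
  using word_prod_eqI[of "[(p, p)]" "[]"] by simp

text \<open>The word for \<open>star (V (p + q)) * (V p * V q)\<close>, completed by
  \<open>V 0 = 1\<close>, is neutral with \<open>K_set\<close> equal to \<open>Sig\<close>, so its
  product is 1.\<close>

lemma V_add: "V (p + q) = V p * V q"
proof -
  have "x + int_of_sig q \<in> Sig" if "x \<in> Sig" for x
    using that int_of_sig[of q] by (auto simp: Sig_def)
  then have *: "star (V (p + q)) * (V p * V q) = 1"
    using word_prod_eqI[of "[(p + q, p), (0, q)]" "[]"]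
    by (simp add: V_zero mult.assoc) blast
  moreover have "star (V p * V q) * V (p + q) = 1"
    using arg_cong[OF *, of star] by (simp add: star_mult star_star mult.assoc)
  moreover have "star (V p * V q) * (V p * V q) = star (V q) * (star (V p) * V p) * V q"
    by (simp add: star_mult mult.assoc)
  ultimately show ?thesis
    using eq_of_star_mult_eq[of "V (p + q)" 1 "V p * V q"] by (simp add: V_isometry)
qed

abbreviation S where "S \<equiv> V (sig_of_int 2)"
abbreviation T where "T \<equiv> V (sig_of_int 3)"

text \<open>For the left regular representation, \<open>U\<close> moves the basis vector at n to n +
  1 for n at least 2 and annihilates the one at 0. \<open>P\<close> and \<open>E\<close> are then
  the projections onto n at least 2 and onto n = 0.\<close>

definition P where "P = star T * S * star S * T"
definition U where "U = star S * T"
definition E where "E = 1 - P"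

text \<open>
  For the left regular representation \<open>W\<close> is the unilateral shift
  \<open>\<delta>\<^sub>0 \<mapsto> \<delta>\<^sub>2 \<mapsto> \<delta>\<^sub>3 \<mapsto> \<dots>\<close> along the enumeration of \<open>\<Sigma>\<close>.
\<close>

definition W where "W = U + S * E"

lemma S_isometry: "star S * S = 1"
  by (rule V_isometry)

lemma S_T_commute: "T * S = S * T"
  by (metis V_add add.commute)

lemma P_star: "star P = P"
  by (simp add: P_def star_mult star_star mult.assoc)

lemma P_eq: "P = star U * U"
  by (simp add: P_def U_def star_mult star_star mult.assoc)

text \<open>Both sides of each identity are products of neutral words with equal
  \<open>K_set\<close>; entries \<open>0\<close> supply \<open>V 0 = 1\<close> where a generator or
  its adjoint stands alone.\<close>

lemma word_identities:
  "P * P = P"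
  "star S * (U * star U) * S = P"
  "star U * P * U = P"
  "star S * P * S = 1"
  "star (U * U) * (U * U) = P"
  "star (U * U) * (S * P) = P"
  "U * star U * P = U * star U"
  "U * star U * (S * star S) = S * P * star S"
  "U * star U * (T * star T) = T * star T"
  "U * star U * (S * star S * T * star T) = S * star S * T * star T"
proof -
  let ?s = "sig_of_int 2" and ?t = "sig_of_int 3"
  note defs = P_def U_def star_mult star_star mult.assoc V_zero
  show "P * P = P"
    using word_prod_eqI[of "[(?t, ?s), (?s, ?t), (?t, ?s), (?s, ?t)]" "[(?t, ?s), (?s, ?t)]"]
    by (simp add: defs) blast
  show "star S * (U * star U) * S = P"
    using word_prod_eqI[of "[(?s, 0), (?s, ?t), (?t, ?s), (0, ?s)]" "[(?t, ?s), (?s, ?t)]"]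
    by (simp add: defs) (fastforce simp: Sig_def)
  show "star U * P * U = P"
    using word_prod_eqI[of "[(?t, ?s), (?t, ?s), (?s, ?t), (?s, ?t)]" "[(?t, ?s), (?s, ?t)]"]
    by (simp add: defs) (fastforce simp: Sig_def)
  show "star S * P * S = 1"
    using word_prod_eqI[of "[(?s, 0), (?t, ?s), (?s, ?t), (0, ?s)]" "[]"]
    by (simp add: defs) (fastforce simp: Sig_def)
  show "star (U * U) * (U * U) = P"
    using word_prod_eqI[of "[(?t, ?s), (?t, ?s), (?s, ?t), (?s, ?t)]" "[(?t, ?s), (?s, ?t)]"]
    by (simp add: defs) (fastforce simp: Sig_def)
  show "star (U * U) * (S * P) = P"
    using word_prod_eqI[of "[(?t, ?s), (?t, ?s), (0, ?s), (?t, ?s), (?s, ?t)]" "[(?t, ?s), (?s, ?t)]"]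
    by (simp add: defs) (fastforce simp: Sig_def)
  show "U * star U * P = U * star U"
    using word_prod_eqI[of "[(?s, ?t), (?t, ?s), (?t, ?s), (?s, ?t)]" "[(?s, ?t), (?t, ?s)]"]
    by (simp add: defs) (fastforce simp: Sig_def)
  show "U * star U * (S * star S) = S * P * star S"
    using word_prod_eqI[of "[(?s, ?t), (?t, ?s), (0, ?s), (?s, 0)]" "[(0, ?s), (?t, ?s), (?s, ?t), (?s, 0)]"]
    by (simp add: defs) (fastforce simp: Sig_def)
  show "U * star U * (T * star T) = T * star T"
    using word_prod_eqI[of "[(?s, ?t), (?t, ?s), (0, ?t), (?t, 0)]" "[(0, ?t), (?t, 0)]"]
    by (simp add: defs) (fastforce simp: Sig_def)
  show "U * star U * (S * star S * T * star T) = S * star S * T * star T"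
    using word_prod_eqI[of "[(?s, ?t), (?t, ?s), (0, ?s), (?s, 0), (0, ?t), (?t, 0)]"
        "[(0, ?s), (?s, 0), (0, ?t), (?t, 0)]"]
    by (simp add: defs) (fastforce simp: Sig_def)
qed

lemma E_simps: "star E = E" "P * E = 0" "E * P = 0" "E * E = E"
  by (simp_all add: E_def star_diff P_star algebra_simps word_identities)

text \<open>Here and in the next three facts, (T3) does not reach the product z itself, so its
  vanishing is read off from \<open>star z * z = 0\<close>.\<close>

lemma U_E: "U * E = 0"
proof -
  have "star (U * E) * (U * E) = E * P * E"
    by (simp add: P_eq star_mult E_simps(1) mult.assoc)
  then show ?thesis
    using star_mult_eq_zeroD[of "U * E"] by (simp add: E_simps)
qed

lemma star_U_S_E: "star U * S * E = 0"
proof -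
  have "star (star U * S * E) * (star U * S * E) = E * (star S * (U * star U) * S) * E"
    by (simp add: star_mult star_star E_simps(1) mult.assoc)
  then show ?thesis
    using star_mult_eq_zeroD[of "star U * S * E"] by (simp add: word_identities E_simps)
qed

lemma E_U: "E * U = 0"
proof -
  have "star (E * U) * (E * U) = star U * (E * E) * U"
    by (simp add: star_mult E_simps(1) mult.assoc)
  also have "\<dots> = star U * U - star U * P * U"
    unfolding E_simps by (simp add: E_def algebra_simps)
  finally show ?thesis
    using star_mult_eq_zeroD[of "E * U"] by (simp add: word_identities flip: P_eq)
qed

lemma E_S: "E * S = 0"
proof -
  have "star (E * S) * (E * S) = star S * (E * E) * S"
    by (simp add: star_mult E_simps(1) mult.assoc)
  also have "\<dots> = star S * S - star S * P * S"
    unfolding E_simps by (simp add: E_def algebra_simps)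
  finally show ?thesis
    using star_mult_eq_zeroD[of "E * S"] by (simp add: word_identities S_isometry)
qed

lemma U_U: "U * U = S * P"
proof (rule eq_of_star_mult_eq)
  show "star (U * U) * (U * U) = P" "star (U * U) * (S * P) = P"
    by (rule word_identities)+
  show "star (S * P) * (U * U) = P"
    using arg_cong[OF word_identities(6), of star] by (simp add: star_mult[of "star (U * U)"] star_star P_star)
  have "star (S * P) * (S * P) = P * (star S * S) * P"
    by (simp add: star_mult P_star mult.assoc)
  then show "star (S * P) * (S * P) = P"
    by (simp add: S_isometry word_identities)
qed

section \<open>The isometry \<open>W\<close> and the recovery of \<open>S\<close> and
  \<open>T\<close>\<close>

text \<open>The summands \<open>U\<close> and \<open>S * E\<close> have complementary initial
  projections \<open>P\<close> and \<open>E\<close>, and orthogonal ranges by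
  \<open>star_U_S_E\<close>.\<close>

lemma W_isometry: "star W * W = 1"
proof -
  have "E * (star S * U) = 0"
    using arg_cong[OF star_U_S_E, of star] by (simp add: star_mult star_star E_simps(1) mult.assoc)
  moreover have "E * (star S * (S * E)) = E"
    using S_isometry by (simp add: E_simps flip: mult.assoc)
  moreover have "star W * W = star U * U + star U * S * E + E * (star S * U) + E * (star S * (S * E))"
    by (simp add: W_def star_add star_mult E_simps(1) algebra_simps)
  ultimately show ?thesis
    using star_U_S_E by (simp add: E_def flip: P_eq)
qed

lemma W_range: "W * star W = P"
proof -
  have EU: "E * star U = 0"
    using arg_cong[OF U_E, of star] by (simp add: star_mult E_simps(1))
  have "W * star W = U * star U + U * E * star S + S * (E * star U) + S * (E * E) * star S"
    by (simp add: W_def star_add star_mult E_simps(1) algebra_simps)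
  \<comment> \<open>The factor \<open>P\<close> is inserted so that the extra relation can expand
    it. Afterwards \<open>S * P * star S\<close> and \<open>S * E * star S\<close> add up to
    \<open>S * star S\<close>, and the relation is read backwards.\<close>
  also have "\<dots> = U * star U * P + S * E * star S"
    by (simp add: U_E EU E_simps word_identities)
  also have "U * star U * P = U * star U * (S * star S) + U * star U * (T * star T)
      - U * star U * (S * star S * T * star T)"
    unfolding P_def extra by (simp add: algebra_simps)
  also have "\<dots> = S * P * star S + T * star T - S * star S * T * star T"
    by (simp only: word_identities)
  also have "\<dots> + S * E * star S = P"
    unfolding E_def P_def extra by (simp add: algebra_simps)
  finally show ?thesis .
qed

lemma W_E: "W * E = S * E"
  by (simp add: W_def algebra_simps U_E E_simps)

lemma W_P: "W * P = U"
proof -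
  have "W * P = U * (1 - E) + S * (E * P)"
    by (simp add: W_def E_def algebra_simps)
  then show ?thesis
    by (simp add: E_simps right_diff_distrib U_E)
qed

lemma W_U: "W * U = S * P"
proof -
  have "W * U = U * U + S * (E * U)"
    by (simp add: W_def algebra_simps)
  then show ?thesis
    by (simp add: E_U U_U)
qed

lemma W_S: "W * S = T"
proof -
  have "W * S = star S * (T * S) + S * (E * S)"
    by (simp add: W_def U_def algebra_simps)
  also have "star S * (T * S) = star S * S * T"
    by (simp add: S_T_commute mult.assoc)
  finally show ?thesis
    by (simp add: S_isometry E_S)
qed

text \<open>\<open>S * E = W * E\<close> and \<open>S * P = W * U = W * (W * P)\<close>. Together
  with \<open>W_range\<close> and \<open>W_S\<close> this puts \<open>S\<close> and \<open>T\<close>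
  in the algebra generated by 1 and \<open>W\<close>.\<close>

lemma S_eq_W: "S = W * E + W * (W * P)"
  unfolding W_P W_U W_E by (simp add: E_def algebra_simps)

end

text \<open>The extra relation is inclusion-exclusion for the union of 2 + \<Sigma> and 3 +
  \<Sigma>, which is \<Sigma> without 0.\<close>

lemma sigma_toeplitz_left_shift: "sigma_toeplitz (left_shift :: sig \<Rightarrow> sig ell2_op)"
proof
  let ?s = "sig_of_int 2" and ?t = "sig_of_int 3"
  let ?L = "left_shift :: sig \<Rightarrow> sig ell2_op"
  let ?w = "word_prod ?L"
  show "toeplitz_relations ?L"
    by (rule toeplitz_relations_left_shift)
  have "?w [(?t, ?s), (?s, ?t)] + ?w [(0, ?s), (?s, 0), (0, ?t), (?t, 0)]
      = ?w [(0, ?s), (?s, 0)] + ?w [(0, ?t), (?t, 0)]"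
  proof (rule op_eq_on_kets)
    fix r
    have "int_of_sig r \<ge> 0" "int_of_sig r \<noteq> 1"
      using int_of_sig[of r] by (simp_all add: Sig_def)
    then show "op_apply (?w [(?t, ?s), (?s, ?t)] + ?w [(0, ?s), (?s, 0), (0, ?t), (?t, 0)]) (ket r)
        = op_apply (?w [(0, ?s), (?s, 0)] + ?w [(0, ?t), (?t, 0)]) (ket r)"
      unfolding op_apply_simps(2)
      by (simp add: word_prod_left_shift_ket_neutral neutral_iff_word_shift del: word_prod_simps)
        (auto simp: Sig_def)
  qed
  then show "star (?L ?t) * ?L ?s * star (?L ?s) * ?L ?t
      = ?L ?s * star (?L ?s) + ?L ?t * star (?L ?t) - ?L ?s * star (?L ?s) * ?L ?t * star (?L ?t)"
    by (simp add: left_shift_zero mult.assoc algebra_simps)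
qed

text \<open>\<open>P\<close> annihilates \<open>ket 0\<close>, because 3 - 2 = 1 is missing from
  \<open>Sig\<close>.\<close>

lemma left_shift_range_neq_one: "sigma_toeplitz.P (left_shift :: sig \<Rightarrow> sig ell2_op) \<noteq> 1"
proof
  assume P: "sigma_toeplitz.P (left_shift :: sig \<Rightarrow> sig ell2_op) = 1"
  have "op_apply (word_prod left_shift [(sig_of_int 3, sig_of_int 2), (sig_of_int 2, sig_of_int 3)]) (ket (0 :: sig)) = 0"
    by (simp add: word_prod_left_shift_ket_neutral neutral_iff_word_shift Sig_def del: word_prod_simps)
  moreover have "word_prod left_shift [(sig_of_int 3, sig_of_int 2), (sig_of_int 2, sig_of_int 3)]
      = (1 :: sig ell2_op)"
    using P unfolding sigma_toeplitz.P_def[OF sigma_toeplitz_left_shift] by (simp add: mult.assoc)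
  ultimately have "coord (ket (0 :: sig)) 0 = coord 0 (0 :: sig)"
    by (metis op_apply_simps(1))
  then show False
    by (simp add: coord_ket)
qed

text \<open>The same formulas express the generators through 1 and \<open>W\<close> in both
  families, and \<open>G\<close> is closed under every operation in them.\<close>

lemma sigma_toeplitz_in_star_relation:
  assumes V: "sigma_toeplitz V" and V': "sigma_toeplitz V'" and G: "star_relation G"
    and one: "(1, 1) \<in> G" and W: "(sigma_toeplitz.W V, sigma_toeplitz.W V') \<in> G"
  shows "(V p, V' p) \<in> G"
proof -
  interpret V: sigma_toeplitz V by fact
  interpret V': sigma_toeplitz V' by fact
  have P: "(V.P, V'.P) \<in> G"
    unfolding V.W_range[symmetric] V'.W_range[symmetric] by (intro star_relationD[OF G] W)
  have E: "(V.E, V'.E) \<in> G"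
    unfolding V.E_def V'.E_def by (intro star_relation_diff[OF G] one P)
  have S: "(V.S, V'.S) \<in> G"
    by (subst V.S_eq_W, subst V'.S_eq_W) (intro star_relationD[OF G] W E P)
  have T: "(V.T, V'.T) \<in> G"
    unfolding V.W_S[symmetric] V'.W_S[symmetric] by (intro star_relationD[OF G] W S)
  show ?thesis
  proof (induction "nat (int_of_sig p)" arbitrary: p rule: less_induct)
    case less
    \<comment> \<open>3 is the only non-zero element of \<open>Sig\<close> from which 2 cannot be
      subtracted within \<open>Sig\<close>.\<close>
    consider "int_of_sig p = 0" | "int_of_sig p = 3" | "int_of_sig p \<ge> 2" "int_of_sig p - 2 \<in> Sig"
      using int_of_sig[of p] by (fastforce simp: Sig_def)
    then show ?case
    proof cases
      case 1
      then have "p = 0"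
        by (simp flip: int_of_sig_inject)
      then show ?thesis
        by (simp add: V.V_zero V'.V_zero one)
    next
      case 2
      then have "p = sig_of_int 3"
        by (simp flip: int_of_sig_inject)
      then show ?thesis
        by (simp add: T)
    next
      case 3
      define q where "q = sig_of_int (int_of_sig p - 2)"
      have q: "int_of_sig q = int_of_sig p - 2"
        using 3 by (simp add: q_def sig_of_int_inverse)
      then have "p = sig_of_int 2 + q"
        by (simp flip: int_of_sig_inject)
      moreover have "(V q, V' q) \<in> G"
        using 3 q by (intro less) simp
      ultimately show ?thesis
        by (simp add: V.V_add V'.V_add star_relationD(3)[OF G S])
    qed
  qed
qed

section \<open>The universal property and the uniqueness theorem\<close>

theorem proposition7p4:
  fixes V :: "sig \<Rightarrow> 'a::unital_cstar_algebra"
  assumes "toeplitz_relations V"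
    and "star (V (sig_of_int 3)) * V (sig_of_int 2) * star (V (sig_of_int 2)) * V (sig_of_int 3)
         = V (sig_of_int 2) * star (V (sig_of_int 2)) + V (sig_of_int 3) * star (V (sig_of_int 3))
           - V (sig_of_int 2) * star (V (sig_of_int 2)) * V (sig_of_int 3) * star (V (sig_of_int 3))"
  shows "(\<exists>\<pi>. star_hom (reduced_toeplitz :: sig ell2_op set) (cstar_generated (range V)) \<pi>
            \<and> (\<forall>p. \<pi> (left_shift p) = V p))
       \<and> (\<forall>\<pi>. star_hom (reduced_toeplitz :: sig ell2_op set) (cstar_generated (range V)) \<pi>
            \<and> (\<forall>p. \<pi> (left_shift p) = V p)
          \<longrightarrow> (star_iso reduced_toeplitz (cstar_generated (range V)) \<pi>
               \<longleftrightarrow> star (V (sig_of_int 3)) * V (sig_of_int 2) * star (V (sig_of_int 2)) * V (sig_of_int 3) \<noteq> 1))"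
proof -
  interpret V: sigma_toeplitz V
    by standard (fact assms)+
  interpret L: sigma_toeplitz "left_shift :: sig \<Rightarrow> sig ell2_op"
    by (rule sigma_toeplitz_left_shift)
  let ?A = "reduced_toeplitz :: sig ell2_op set" and ?B = "cstar_generated (range V)"
  have A: "cstar_subalgebra ?A" and LA: "left_shift p \<in> ?A" for p
    unfolding reduced_toeplitz_def
    using cstar_generated_superset[of "range left_shift"] by (auto intro: cstar_subalgebra_generated)
  have B: "cstar_subalgebra ?B" and VB: "V p \<in> ?B" for p
    using cstar_generated_superset[of "range V"] by (auto intro: cstar_subalgebra_generated)
  have oneA: "1 \<in> ?A"
    using LA[of 0] by (simp add: left_shift_zero)
  define G where "G = (\<Union>N. toeplitz_pairs L.W V.W N)"
  \<comment> \<open>\<open>H\<close> will be the graph of the homomorphism; the intersection keeps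
    its coordinates inside the two generated algebras.\<close>
  define H where "H = closure G \<inter> ?A \<times> ?B"
  have G: "star_relation G"
    unfolding G_def by (intro star_relation_toeplitz_pairs L.W_isometry V.W_isometry)
  have "(1, 1) \<in> G" "(L.W, V.W) \<in> G"
    using toeplitz_pairs_monomial[of 0 2 0 L.W V.W] toeplitz_pairs_monomial[of 1 2 0 L.W V.W]
    by (auto simp: G_def toeplitz_monomial_def)
  then have "(left_shift p, V p) \<in> G" for p
    by (rule sigma_toeplitz_in_star_relation[OF L.sigma_toeplitz_axioms V.sigma_toeplitz_axioms G])
  then have gen: "(left_shift p, V p) \<in> H" for p
    using closure_subset[of G] by (auto simp: H_def LA VB)
  have H: "star_relation H" "closed H"
    unfolding H_def using A B star_relation_closure[OF G]
    by (simp_all add: star_relation_Int_Times closed_Int closed_Times cstar_subalgebraD(1))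
  \<comment> \<open>The estimate applies because \<open>L.W\<close> is not unitary: its range
    projection \<open>L.P\<close> differs from 1.\<close>
  have contr: "norm y \<le> norm x" if "(x, y) \<in> H" for x y
  proof (rule norm_le_closure[of G])
    show "(x, y) \<in> closure G"
      using that by (simp add: H_def)
    show "norm y \<le> norm x" if "(x, y) \<in> G" for x y
      using that toeplitz_pairs_contractive[OF L.W_isometry _ V.W_isometry] left_shift_range_neq_one
      unfolding G_def L.W_range by blast
  qed
  obtain \<pi>0 where \<pi>0: "star_hom ?A ?B \<pi>0" "\<And>x y. (x, y) \<in> H \<Longrightarrow> \<pi>0 x = y"
    using star_hom_of_contractive_relation[OF H(2,1) contr, of "range left_shift" ?B] gen
    unfolding reduced_toeplitz_def H_def by blast
  have \<pi>0_gen: "\<pi>0 (left_shift p) = V p" for p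
    by (rule \<pi>0(2)[OF gen])
  have "star_iso ?A ?B \<pi> \<longleftrightarrow> V.P \<noteq> 1"
    if \<pi>: "star_hom ?A ?B \<pi>" "\<And>p. \<pi> (left_shift p) = V p" for \<pi>
  proof
    assume iso: "star_iso ?A ?B \<pi>"
    \<comment> \<open>\<open>L.P\<close> and 1 are distinct elements of \<open>?A\<close>, so an
      injective \<open>\<pi>\<close> keeps their images distinct.\<close>
    have "\<pi> L.P = V.P"
      unfolding L.P_def V.P_def
      by (simp add: star_homD(4,5)[OF \<pi>(1)] \<pi>(2) LA cstar_subalgebraD[OF A])
    moreover have "\<pi> 1 = 1"
      using \<pi>(2)[of 0] by (simp add: left_shift_zero V.V_zero)
    moreover have "L.P \<in> ?A"
      unfolding L.P_def by (intro cstar_subalgebraD[OF A] LA)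
    ultimately show "V.P \<noteq> 1"
      using iso oneA left_shift_range_neq_one unfolding star_iso_def bij_betw_def
      by (metis inj_onD)
  next
    assume ne: "V.P \<noteq> 1"
    \<comment> \<open>Now \<open>V.W\<close> is not unitary either, so the estimate also holds with
      the two isometries exchanged.\<close>
    have contr': "norm x \<le> norm y" if "(y, x) \<in> H\<inverse>" for x y
    proof (rule norm_le_closure[of "G\<inverse>"])
      have "prod.swap ` closure G \<subseteq> closure (G\<inverse>)"
        using closure_subset[of "G\<inverse>"]
        by (intro image_closure_subset) (auto intro!: continuous_intros)
      then show "(y, x) \<in> closure (G\<inverse>)"
        using that by (force simp: H_def)
      show "norm x \<le> norm y" if "(y, x) \<in> G\<inverse>" for x y
      proof -
        have "\<exists>N. (y, x) \<in> toeplitz_pairs V.W L.W N"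
          using that unfolding G_def toeplitz_pairs_def by blast
        then show ?thesis
          using toeplitz_pairs_contractive[OF V.W_isometry _ L.W_isometry] ne
          unfolding V.W_range by blast
      qed
    qed
    have "closed (prod.swap -` H)"
      by (intro continuous_closed_vimage H) (auto intro!: continuous_intros)
    moreover have "prod.swap -` H = H\<inverse>"
      by auto
    \<comment> \<open>The second coordinates of \<open>H\<close> form a C*-subalgebra containing all
      \<open>V p\<close>, which gives surjectivity.\<close>
    ultimately have "cstar_subalgebra (Domain (H\<inverse>))"
      by (intro cstar_subalgebra_Domain star_relation_converse H contr') simp_all
    then have "?B \<subseteq> Domain (H\<inverse>)"
      using gen by (intro cstar_generated_least) blast+
    then have surj: "\<exists>x\<in>?A. (x, y) \<in> H" if "y \<in> ?B" for y
      using that unfolding H_def by blast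
    have "cstar_subalgebra (Domain H)"
      by (intro cstar_subalgebra_Domain H contr)
    then have "?A \<subseteq> Domain H"
      using gen unfolding reduced_toeplitz_def by (intro cstar_generated_least) blast+
    then have graph: "(x, \<pi>0 x) \<in> H" if "x \<in> ?A" for x
      using that \<pi>0(2) by blast
    \<comment> \<open>The given \<open>\<pi>\<close> is arbitrary; agreement on generators
      identifies it with the map whose graph is \<open>H\<close>.\<close>
    have eq: "\<pi> x = \<pi>0 x" if "x \<in> ?A" for x
      using star_hom_eq_on_generated[of "range left_shift" ?B \<pi> ?B \<pi>0 x] \<pi> \<pi>0(1) \<pi>0_gen oneA that
      unfolding reduced_toeplitz_def by fastforce
    have "inj_on \<pi> ?A"
    proof (rule inj_onI)
      fix x x' assume x: "x \<in> ?A" "x' \<in> ?A" "\<pi> x = \<pi> x'"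
      then have "(\<pi>0 x - \<pi>0 x', x - x') \<in> H\<inverse>"
        using star_relation_diff[OF H(1) graph graph] by blast
      then show "x = x'"
        using contr' x by (fastforce simp: eq)
    qed
    moreover have "\<pi> ` ?A = ?B"
      using surj \<pi>0(2) eq star_homD(1)[OF \<pi>(1)] by fastforce
    ultimately show "star_iso ?A ?B \<pi>"
      using \<pi>(1) unfolding star_iso_def bij_betw_def by blast
  qed
  then show ?thesis
    using \<pi>0(1) \<pi>0_gen unfolding V.P_def by blast
qed

end
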